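(* Let $T$ be a $(d_0,d_1)$-biregular tree with $d_0,d_1\ge 3$. Let $G$ be a non-compact, closed, topologically simple subgroup of $\operatorname{Aut}(T)$ acting transitively on $\partial T$ and satisfying Tits' independence property. Let $\xi\in\partial T$, let $G^0_\xi\le G$ be the horospherical stabilizer of $\xi$, let $\Gamma$ be a uniform (cocompact) lattice in $G$ and $X=G/\Gamma$. Then the action of $G^0_\xi$ on the compact space $X$ is minimal, i.e. every $G^0_\xi$-orbit is dense in $X$.
   Context: $\operatorname{Aut}(T)$ denotes the group of automorphisms of $T$ acting without edge inversion; when $d_0=d_1$ this means the group of type-preserving automorphisms (those preserving the bipartition of the vertices). It carries the topology of pointwise convergence on vertices. For a subgraph $D$ of $T$, $G_D$ is the pointwise stabilizer of $D$ in $G$. For an oriented edge $[x,y]$, $T_{[x,y]}$ is the unique maximal subtree of $T$ that contains the edge $[x,y]$ but contains no neighbor of $x$ other than $y$. $G$ has Tits' independence property if $G_{[x,y]}=G_{T_{[x,y]}}G_{T_{[y,x]}}$ for every edge $[x,y]$ of $T$. The horospherical stabilizer of $\xi$ is $G^0_\xi=\{g\in G: g\xi=\xi,\ g\text{ elliptic}\}$, where elliptic means fixing a vertex of $T$. $G$ acts on $X$ by left translation. *)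

theory Defs
  imports
    "HOL-Analysis.Analysis"
    "HOL-Algebra.Bij"
    "HOL-Algebra.Left_Coset"
    "HOL-Algebra.Group_Action"
    "Graph_Theory.Digraph_Component"
begin

section \<open>Biregular trees\<close>

text \<open>
  Undirected graphs are loop-free symmetric digraphs, an undirected edge being a pair of opposite
  arcs. The predicate \<^const>\<open>Digraph_Component.tree\<close> is of no use here: it forbids every directed
  cycle, including the cycles of length 2 formed by an arc and its reverse. The vertex set may be
  infinite.
\<close>

locale undirected_tree = pair_bidirected_digraph T for T :: "'v pair_pre_digraph" +
  assumes connected: "Digraph_Component.connected (with_proj T)"
    and acyclic: "\<not> (\<exists>p. pre_digraph.cycle (with_proj T) p \<and> length p \<ge> 3)"

text \<open>
  The degrees are natural numbers, and \<^const>\<open>card\<close> vanishes on infinite sets, so for positive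
  \<open>d0\<close> and \<open>d1\<close> such a tree is locally finite.
\<close>

locale biregular_tree = undirected_tree T
  for T :: "'v pair_pre_digraph" and V0 V1 :: "'v set" and d0 d1 :: nat +
  assumes partition: "V0 \<union> V1 = pverts T" "V0 \<inter> V1 = {}"
    and bipartite: "\<And>u v. (u, v) \<in> parcs T \<Longrightarrow> u \<in> V0 \<longleftrightarrow> v \<in> V1"
    and degree0: "\<And>v. v \<in> V0 \<Longrightarrow> out_degree (with_proj T) v = d0"
    and degree1: "\<And>v. v \<in> V1 \<Longrightarrow> out_degree (with_proj T) v = d1"


section \<open>The automorphism group\<close>

definition graph_automorphisms :: "'v pair_pre_digraph \<Rightarrow> ('v \<Rightarrow> 'v) set" where
  "graph_automorphisms T =
    {f \<in> Bij (pverts T). \<forall>u\<in>pverts T. \<forall>v\<in>pverts T. (f u, f v) \<in> parcs T \<longleftrightarrow> (u, v) \<in> parcs T}"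

text \<open>
  \<open>aut_group T V0 V1\<close> is \<open>Aut(T)\<close>, for a tree \<open>T\<close> with bipartition \<open>V0\<close>, \<open>V1\<close>: the
  type-preserving automorphisms. They never invert an edge, and if \<open>d0 \<noteq> d1\<close> they are all the
  automorphisms; see the lemmas below.
\<close>

definition aut_group :: "'v pair_pre_digraph \<Rightarrow> 'v set \<Rightarrow> 'v set \<Rightarrow> ('v \<Rightarrow> 'v) monoid" where
  "aut_group T V0 V1 =
    (BijGroup (pverts T))\<lparr>carrier := {f \<in> graph_automorphisms T. f ` V0 = V0 \<and> f ` V1 = V1}\<rparr>"

definition aut_topology :: "'v pair_pre_digraph \<Rightarrow> 'v set \<Rightarrow> 'v set \<Rightarrow> ('v \<Rightarrow> 'v) topology" where
  "aut_topology T V0 V1 =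
    subtopology (product_topology (\<lambda>_. discrete_topology (pverts T)) (pverts T))
      (carrier (aut_group T V0 V1))"

lemma topspace_aut_topology [simp]:
  "topspace (aut_topology T V0 V1) = carrier (aut_group T V0 V1)"
  by (auto simp: aut_topology_def aut_group_def graph_automorphisms_def Bij_def PiE_def
      extensional_def bij_betw_def)

lemma (in biregular_tree) aut_group_no_inversion:
  assumes "f \<in> carrier (aut_group T V0 V1)" "(u, v) \<in> parcs T"
  shows "\<not> (f u = v \<and> f v = u)"
proof
  assume inv: "f u = v \<and> f v = u"
  have "u \<in> V0 \<or> u \<in> V1"
    using assms(2) in_arcsD1 partition(1) by blast
  moreover have "f ` V0 = V0" "f ` V1 = V1"
    using assms(1) by (auto simp: aut_group_def)
  ultimately show False
    using inv bipartite[OF assms(2)] partition by blast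
qed

lemma (in biregular_tree) out_degree_graph_automorphism:
  assumes "f \<in> graph_automorphisms T" "u \<in> pverts T"
  shows "out_degree (with_proj T) (f u) = out_degree (with_proj T) u"
proof -
  have bij: "bij_betw f (pverts T) (pverts T)"
    and arc: "\<And>a b. a \<in> pverts T \<Longrightarrow> b \<in> pverts T \<Longrightarrow> (f a, f b) \<in> parcs T \<longleftrightarrow> (a, b) \<in> parcs T"
    using assms(1) by (auto simp: graph_automorphisms_def Bij_def)
  have inj: "inj_on f (pverts T)" and img: "f ` pverts T = pverts T"
    using bij by (auto simp: bij_betw_def)
  have "bij_betw (map_prod f f) (out_arcs (with_proj T) u) (out_arcs (with_proj T) (f u))"
    unfolding bij_betw_def
  proof
    show "inj_on (map_prod f f) (out_arcs (with_proj T) u)"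
      using inj by (auto simp: inj_on_def) (meson in_arcsD2)
    show "map_prod f f ` out_arcs (with_proj T) u = out_arcs (with_proj T) (f u)"
    proof (intro equalityI subsetI)
      fix e assume "e \<in> map_prod f f ` out_arcs (with_proj T) u"
      then show "e \<in> out_arcs (with_proj T) (f u)"
        using arc assms(2) in_arcsD2 by auto
    next
      fix e assume "e \<in> out_arcs (with_proj T) (f u)"
      then obtain w where w: "e = (f u, w)" "(f u, w) \<in> parcs T"
        by (cases e) auto
      then obtain z where "z \<in> pverts T" "w = f z"
        using img in_arcsD2 by blast
      then show "e \<in> map_prod f f ` out_arcs (with_proj T) u"
        using w arc assms(2) by (auto intro!: image_eqI[of _ _ "(u, z)"])
    qed
  qed
  then show ?thesis
    by (simp add: out_degree_def bij_betw_same_card)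
qed

lemma (in biregular_tree) aut_group_eq_graph_automorphisms:
  assumes "d0 \<noteq> d1"
  shows "carrier (aut_group T V0 V1) = graph_automorphisms T"
proof -
  have V0: "V0 = {v \<in> pverts T. out_degree (with_proj T) v = d0}"
    and V1: "V1 = {v \<in> pverts T. out_degree (with_proj T) v = d1}"
    using partition degree0 degree1 assms by auto
  have "f ` {v \<in> pverts T. out_degree (with_proj T) v = d} =
      {v \<in> pverts T. out_degree (with_proj T) v = d}" if f: "f \<in> graph_automorphisms T" for f d
  proof -
    have "f ` pverts T = pverts T"
      using f by (auto simp: graph_automorphisms_def Bij_def bij_betw_def)
    then show ?thesis
      using out_degree_graph_automorphism[OF f] by (auto simp: image_iff) (metis imageE)
  qed
  then show ?thesis
    using V0 V1 by (auto simp: aut_group_def)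
qed


section \<open>The boundary\<close>

definition rays :: "'v pair_pre_digraph \<Rightarrow> (nat \<Rightarrow> 'v) set" where
  "rays T = {r. inj r \<and> (\<forall>n. (r n, r (Suc n)) \<in> parcs T)}"

definition ray_rel :: "'v pair_pre_digraph \<Rightarrow> (nat \<Rightarrow> 'v) rel" where
  "ray_rel T = {(r, s). r \<in> rays T \<and> s \<in> rays T \<and> (\<exists>m n. \<forall>k. r (m + k) = s (n + k))}"

definition tree_boundary :: "'v pair_pre_digraph \<Rightarrow> (nat \<Rightarrow> 'v) set set" where
  "tree_boundary T = rays T // ray_rel T"

definition boundary_action :: "('v \<Rightarrow> 'v) \<Rightarrow> (nat \<Rightarrow> 'v) set \<Rightarrow> (nat \<Rightarrow> 'v) set" where
  "boundary_action g \<xi> = (\<lambda>r. g \<circ> r) ` \<xi>"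

definition transitive_on_boundary :: "'v pair_pre_digraph \<Rightarrow> ('v \<Rightarrow> 'v) set \<Rightarrow> bool" where
  "transitive_on_boundary T G \<longleftrightarrow>
    (\<forall>\<xi>\<in>tree_boundary T. \<forall>\<eta>\<in>tree_boundary T. \<exists>g\<in>G. boundary_action g \<xi> = \<eta>)"

definition elliptic :: "'v pair_pre_digraph \<Rightarrow> ('v \<Rightarrow> 'v) \<Rightarrow> bool" where
  "elliptic T g \<longleftrightarrow> (\<exists>v\<in>pverts T. g v = v)"

definition horospherical_stabilizer ::
    "'v pair_pre_digraph \<Rightarrow> ('v \<Rightarrow> 'v) set \<Rightarrow> (nat \<Rightarrow> 'v) set \<Rightarrow> ('v \<Rightarrow> 'v) set" where
  "horospherical_stabilizer T G \<xi> = {g \<in> G. boundary_action g \<xi> = \<xi> \<and> elliptic T g}"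


section \<open>Tits' independence property\<close>

definition pointwise_stabilizer :: "('v \<Rightarrow> 'v) set \<Rightarrow> 'v pair_pre_digraph \<Rightarrow> ('v \<Rightarrow> 'v) set" where
  "pointwise_stabilizer G D = {g \<in> G. \<forall>v\<in>pverts D. g v = v}"

definition edge_subgraph :: "'v \<Rightarrow> 'v \<Rightarrow> 'v pair_pre_digraph" where
  "edge_subgraph x y = \<lparr>pverts = {x, y}, parcs = {(x, y), (y, x)}\<rparr>"

definition edge_subtree :: "'v pair_pre_digraph \<Rightarrow> 'v \<Rightarrow> 'v \<Rightarrow> 'v pair_pre_digraph \<Rightarrow> bool" where
  "edge_subtree T x y D \<longleftrightarrow>
    undirected_tree D \<and> subgraph (with_proj D) (with_proj T) \<and>
    subgraph (with_proj (edge_subgraph x y)) (with_proj D) \<and>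
    (\<forall>z\<in>pverts D. (x, z) \<in> parcs T \<longrightarrow> z = y)"

text \<open>
  If \<open>[x, y]\<close> is an edge of the tree \<open>T\<close>, the subtrees in \<^const>\<open>edge_subtree\<close> all contain this
  edge, so their union is again one of them, and it is the unique maximal one.
\<close>

definition half_tree :: "'v pair_pre_digraph \<Rightarrow> 'v \<Rightarrow> 'v \<Rightarrow> 'v pair_pre_digraph" where
  "half_tree T x y = (THE D. edge_subtree T x y D \<and>
    (\<forall>D'. edge_subtree T x y D' \<and> subgraph (with_proj D) (with_proj D') \<longrightarrow> D' = D))"

definition tits_independence :: "'v pair_pre_digraph \<Rightarrow> ('v \<Rightarrow> 'v) set \<Rightarrow> bool" where
  "tits_independence T G \<longleftrightarrow>
    (\<forall>(x, y) \<in> parcs T. pointwise_stabilizer G (edge_subgraph x y) =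
      pointwise_stabilizer G (half_tree T x y)
        <#>\<^bsub>BijGroup (pverts T)\<^esub> pointwise_stabilizer G (half_tree T y x))"


section \<open>Topological groups and homogeneous spaces\<close>

definition topologically_simple :: "'g topology \<Rightarrow> ('g, 'm) monoid_scheme \<Rightarrow> bool" where
  "topologically_simple \<tau> G \<longleftrightarrow> carrier G \<noteq> {\<one>\<^bsub>G\<^esub>} \<and>
    (\<forall>N. N \<lhd> G \<and> closedin \<tau> N \<longrightarrow> N = carrier G \<or> N = {\<one>\<^bsub>G\<^esub>})"

definition quotient_topology :: "'a topology \<Rightarrow> ('a \<Rightarrow> 'b) \<Rightarrow> 'b topology" where
  "quotient_topology X q =
    topology (\<lambda>U. U \<subseteq> q ` topspace X \<and> openin X {x \<in> topspace X. q x \<in> U})"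

lemma openin_quotient_topology:
  "openin (quotient_topology X q) U \<longleftrightarrow>
    U \<subseteq> q ` topspace X \<and> openin X {x \<in> topspace X. q x \<in> U}"
proof -
  have "istopology (\<lambda>U. U \<subseteq> q ` topspace X \<and> openin X {x \<in> topspace X. q x \<in> U})"
    unfolding istopology_def
  proof (intro conjI allI impI)
    fix S U
    assume *: "S \<subseteq> q ` topspace X \<and> openin X {x \<in> topspace X. q x \<in> S}"
      "U \<subseteq> q ` topspace X \<and> openin X {x \<in> topspace X. q x \<in> U}"
    then show "S \<inter> U \<subseteq> q ` topspace X"
      by blast
    have "{x \<in> topspace X. q x \<in> S \<inter> U} =
        {x \<in> topspace X. q x \<in> S} \<inter> {x \<in> topspace X. q x \<in> U}"
      by blast
    then show "openin X {x \<in> topspace X. q x \<in> S \<inter> U}"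
      using * by auto
  next
    fix \<K>
    assume *: "\<forall>K\<in>\<K>. K \<subseteq> q ` topspace X \<and> openin X {x \<in> topspace X. q x \<in> K}"
    then show "\<Union>\<K> \<subseteq> q ` topspace X"
      by blast
    have "{x \<in> topspace X. q x \<in> \<Union>\<K>} = (\<Union>K\<in>\<K>. {x \<in> topspace X. q x \<in> K})"
      by blast
    then show "openin X {x \<in> topspace X. q x \<in> \<Union>\<K>}"
      using * by auto
  qed
  then show ?thesis
    by (simp add: quotient_topology_def topology_inverse')
qed

lemma topspace_quotient_topology [simp]: "topspace (quotient_topology X q) = q ` topspace X"
proof -
  have "{x \<in> topspace X. q x \<in> q ` topspace X} = topspace X"
    by blast
  then have "openin (quotient_topology X q) (q ` topspace X)"
    by (simp add: openin_quotient_topology)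
  then show ?thesis
    by (meson openin_quotient_topology openin_subset openin_topspace subset_antisym)
qed

lemma quotient_map_quotient_topology: "quotient_map X (quotient_topology X q) q"
  by (auto simp: quotient_map_def openin_quotient_topology)

text \<open>The underlying set of \<open>coset_space \<tau> G H\<close> is the set \<open>G/H\<close> of left cosets, because the
  underlying set of \<open>\<tau>\<close> is meant to be that of \<open>G\<close>.\<close>

definition coset_space :: "'g topology \<Rightarrow> ('g, 'm) monoid_scheme \<Rightarrow> 'g set \<Rightarrow> 'g set topology" where
  "coset_space \<tau> G H = quotient_topology \<tau> (\<lambda>g. g <#\<^bsub>G\<^esub> H)"

lemma topspace_coset_space:
  "topspace \<tau> = carrier G \<Longrightarrow> topspace (coset_space \<tau> G H) = lcosets\<^bsub>G\<^esub> H"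
  by (auto simp: coset_space_def LCOSETS_def)

text \<open>A discrete cocompact subgroup automatically has finite covolume.\<close>

definition uniform_lattice :: "'g topology \<Rightarrow> ('g, 'm) monoid_scheme \<Rightarrow> 'g set \<Rightarrow> bool" where
  "uniform_lattice \<tau> G \<Gamma> \<longleftrightarrow> subgroup \<Gamma> G \<and> subtopology \<tau> \<Gamma> = discrete_topology \<Gamma> \<and>
    compact_space (coset_space \<tau> G \<Gamma>)"

definition minimal_action ::
    "('g, 'm) monoid_scheme \<Rightarrow> ('g \<Rightarrow> 'x \<Rightarrow> 'x) \<Rightarrow> 'x topology \<Rightarrow> bool" where
  "minimal_action H \<phi> X \<longleftrightarrow> (\<forall>x\<in>topspace X. X closure_of (orbit H \<phi> x) = topspace X)"

end

theory Submission
  imports Defs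
begin

text \<open>
  The group of \<open>g\<close> with \<open>g (r i) = r i\<close> for all large \<open>i\<close> lies in the horospherical stabilizer of the
  end of the ray \<open>r\<close>. Hence it suffices to find, for rays \<open>s\<close>, \<open>t\<close> in the same \<open>G\<close>-orbit and a
  finite set \<open>F\<close> of vertices, some \<open>\<gamma> \<in> \<Gamma>\<close> and some \<open>k \<in> G\<close> fixing \<open>F\<close> such that
  \<open>\<gamma> (s i) = k (t i)\<close> for all large \<open>i\<close>. By Baire's theorem the orbits on the boundary of the
  stabilizer of \<open>F\<close> are open, so it is enough to join an initial segment of \<open>t\<close> to a translate by
  \<open>\<Gamma>\<close> of a tail of \<open>s\<close> by a non-backtracking path of exactly the right length.

  Non-compactness makes \<open>G\<close>, and therefore \<open>\<Gamma>\<close>, act with finitely many orbits of arcs. The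
  non-backtracking walk on arcs modulo \<open>\<Gamma>\<close> preserves a finite measure, as the stabilizers in \<open>\<Gamma>\<close>
  are finite, and so is recurrent; as every vertex has degree at least 3, it is moreover irreducible
  of period 2. All large lengths of the right parity therefore occur.
\<close>

section \<open>Non-backtracking walks\<close>

text \<open>For cosets \<open>g0 \<Gamma>\<close> and \<open>g \<Gamma>\<close> the rays are the
  images \<open>s\<close> and \<open>t\<close> of \<open>r\<close> under the inverses of
  \<open>g0\<close> and \<open>g\<close>. Once \<open>\<gamma> (s i) = k (t i)\<close> for large
  \<open>i\<close>, the product \<open>u\<close> of \<open>g\<close>, the inverse of
  \<open>k\<close>, \<open>\<gamma>\<close> and the inverse of \<open>g0\<close> fixes a tail of
  \<open>r\<close>, while \<open>u g0\<close> times the inverse of \<open>\<gamma>\<close> is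
  \<open>g\<close> times the inverse of \<open>k\<close>, which agrees with \<open>g\<close> on
  \<open>F\<close>.

  The obstacle is the common index \<open>i\<close>. With different shifts on the two sides,
  \<open>u\<close> would translate along \<open>r\<close> and fix no vertex, so it would not be
  elliptic. Transitivity on the boundary gives no control over such shifts; hence the need for
  connecting walks of every large admissible length. The parity condition that remains holds because
  \<open>G\<close> preserves types: \<open>s 0\<close> and \<open>t 0\<close> both have the type of
  \<open>r 0\<close>.

  Compactness of \<open>G/\<Gamma>\<close> by itself bounds the number of \<Gamma>-orbits only
  inside a single \<open>G\<close>-orbit of vertices. That \<open>G\<close> has finitely many vertex
  orbits is a separate matter, and rests on the orbits being infinite.\<close>

context undirected_tree
begin

lemma arc_commute: "(u, v) \<in> parcs T \<longleftrightarrow> (v, u) \<in> parcs T"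
  using pair_sym_arcs by (auto simp: symmetric_def dest: symD)

lemma arc_irrefl: "(u, v) \<in> parcs T \<Longrightarrow> u \<noteq> v"
  using pair_no_loops by fastforce

lemma connected_rtrancl:
  assumes "u \<in> pverts T" "v \<in> pverts T"
  shows "(u, v) \<in> (parcs T)\<^sup>*"
proof -
  have "u \<rightarrow>\<^sup>*\<^bsub>with_proj (mk_symmetric (with_proj T))\<^esub> v"
    using connected assms
    by (auto simp: Digraph_Component.connected_def strongly_connected_def pverts_mk_symmetric)
  then have "(u, v) \<in> rtrancl_on (pverts T) (parcs T)"
    using reachable_mk_symmetric_eq[OF pair_sym_arcs] by (simp add: reachable_def)
  then show ?thesis
    by (induction rule: rtrancl_on_induct) (auto intro: rtrancl.rtrancl_into_rtrancl)
qed

lemma vertex_exists: "pverts T \<noteq> {}"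
  using connected
  by (auto simp: Digraph_Component.connected_def strongly_connected_def pverts_mk_symmetric)

text \<open>A relation on arcs rather than vertices: non-backtracking becomes a condition on two
  consecutive arcs, and walks of a given length are powers of one relation.\<close>

definition nb_step :: "('v \<times> 'v) rel" where
  "nb_step = {(a, b). a \<in> parcs T \<and> b \<in> parcs T \<and> snd a = fst b \<and> snd b \<noteq> fst a}"

lemma nb_step_iff:
  "((u, v), (v', w)) \<in> nb_step \<longleftrightarrow> v' = v \<and> (u, v) \<in> parcs T \<and> (v, w) \<in> parcs T \<and> w \<noteq> u"
  by (auto simp: nb_step_def)

lemma nb_step_arcs: "(a, b) \<in> nb_step \<Longrightarrow> a \<in> parcs T \<and> b \<in> parcs T"
  by (simp add: nb_step_def)

lemma nb_step_swap: "(a, b) \<in> nb_step \<Longrightarrow> (prod.swap b, prod.swap a) \<in> nb_step"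
  by (cases a; cases b) (auto simp: nb_step_iff arc_commute)

lemma nb_relpow_arcs: "(a, b) \<in> nb_step ^^ n \<Longrightarrow> a \<in> parcs T \<longleftrightarrow> b \<in> parcs T"
  by (induction n arbitrary: b) (auto dest: nb_step_arcs)

text \<open>Reduces an ordinary path: if its next vertex reverses the last arc, that arc is
  cancelled, otherwise the new arc is appended. The alternative \<open>z = x\<close> in the
  induction covers the empty walk, which has no arc to record.\<close>

lemma nb_walk_exists:
  assumes "x \<in> pverts T" "y \<in> pverts T" "x \<noteq> y"
  shows "\<exists>x' y'. (x, x') \<in> parcs T \<and> ((x, x'), (y', y)) \<in> nb_step\<^sup>*"
proof -
  have "z = x \<or> (\<exists>x' z'. (x, x') \<in> parcs T \<and> ((x, x'), (z', z)) \<in> nb_step\<^sup>*)"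
    if "(x, z) \<in> (parcs T)\<^sup>*" for z
    using that
  proof (induction rule: rtrancl_induct)
    case (step z w)
    show ?case
    proof (cases "z = x")
      case True
      then show ?thesis using step.hyps(2) by blast
    next
      case False
      then obtain x' z' where x': "(x, x') \<in> parcs T" and r: "((x, x'), (z', z)) \<in> nb_step\<^sup>*"
        using step.IH by blast
      show ?thesis
      proof (cases "w = z'")
        case True
        from r show ?thesis
        proof (cases rule: rtranclE)
          case base
          then show ?thesis using True by blast
        next
          case (step c)
          then show ?thesis using True x' by (cases c) (auto simp: nb_step_iff)
        qed
      next
        case wz: False
        have "(z', z) \<in> parcs T"
          using r x' by (cases rule: rtranclE) (auto dest: nb_step_arcs)
        then have "((z', z), (z, w)) \<in> nb_step"
          using step.hyps(2) wz by (auto simp: nb_step_iff)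
        then show ?thesis using r x' by (meson rtrancl.rtrancl_into_rtrancl)
      qed
    qed
  qed auto
  then show ?thesis
    using connected_rtrancl[OF assms(1,2)] assms(3) by blast
qed

text \<open>The local counterpart of injectivity in \<open>rays\<close>. In a tree the two notions
  agree (\<open>rays_eq\<close>), and this one can be checked at the joint when rays are
  glued.\<close>

definition nonbacktracking :: "(nat \<Rightarrow> 'v) \<Rightarrow> bool" where
  "nonbacktracking r \<longleftrightarrow> (\<forall>n. (r n, r (Suc n)) \<in> parcs T \<and> r (Suc (Suc n)) \<noteq> r n)"

lemma nonbacktracking_step:
  "nonbacktracking r \<Longrightarrow> ((r n, r (Suc n)), (r (Suc n), r (Suc (Suc n)))) \<in> nb_step"
  by (auto simp: nonbacktracking_def nb_step_iff)

lemma nonbacktracking_relpow: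
  "nonbacktracking r \<Longrightarrow> ((r n, r (Suc n)), (r (n + k), r (Suc (n + k)))) \<in> nb_step ^^ k"
  by (induction k) (auto intro: relpow_Suc_I nonbacktracking_step)

lemma nonbacktracking_verts: "nonbacktracking r \<Longrightarrow> r n \<in> pverts T"
  by (auto simp: nonbacktracking_def intro: in_arcsD1)

text \<open>A repetition with the smallest gap \<open>d\<close> is a closed walk without further
  repetitions. Gap 1 would be a loop, gap 2 a backtrack, and a gap of at least 3 a cycle.\<close>

lemma nonbacktracking_inj:
  assumes r: "nonbacktracking r"
  shows "inj r"
proof (rule ccontr)
  assume "\<not> inj r"
  then obtain i j where ij: "i < j" "r i = r j"
    by (metis injI linorder_neqE_nat)
  define d where "d = (LEAST d. 0 < d \<and> (\<exists>i. r i = r (i + d)))"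
  have ex: "0 < j - i \<and> (\<exists>k. r k = r (k + (j - i)))"
    using ij by (auto intro: exI[of _ i])
  have "0 < d \<and> (\<exists>i. r i = r (i + d))"
    unfolding d_def by (rule LeastI, rule ex)
  then obtain i where i: "0 < d" "r i = r (i + d)"
    by blast
  have min: "r k \<noteq> r (k + d')" if "0 < d'" "d' < d" for k d'
    using that not_less_Least[of d' "\<lambda>d. 0 < d \<and> (\<exists>i. r i = r (i + d))"] by (auto simp: d_def)
  have arc: "(r k, r (Suc k)) \<in> parcs T" and nb: "r (Suc (Suc k)) \<noteq> r k" for k
    using r by (auto simp: nonbacktracking_def)
  have "d \<noteq> 1" "d \<noteq> 2"
    using i(2) arc_irrefl[OF arc, of i] nb[of i] by auto
  with i(1) have d3: "d \<ge> 3" by linarith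
  define p where "p = (\<lambda>k n. map (\<lambda>k. (r k, r (Suc k))) [k..<k + n])"
  have p_Suc: "p k (Suc n) = (r k, r (Suc k)) # p (Suc k) n" for k n
    by (simp add: p_def upt_conv_Cons del: upt_Suc)
  have cas: "pcas (r k) (p k n) (r (k + n))" for k n
    by (induction n arbitrary: k) (simp add: p_def, simp add: p_Suc del: add_Suc_right, metis add_Suc_shift)
  have verts: "pawalk_verts (r k) (p k n) = map r [k..<Suc (k + n)]" for k n
  proof (induction n arbitrary: k)
    case (Suc n)
    then show ?case by (simp add: p_Suc upt_conv_Cons del: upt_Suc)
  qed (simp add: p_def)
  have "awalk (r i) (p i d) (r i)"
    using cas[of i d] i arc in_arcsD1[OF arc] by (auto simp: awalk_def p_def)
  moreover have "distinct (tl (pawalk_verts (r i) (p i d)))"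
  proof -
    \<comment> \<open>Indices in this window differ by less than \<open>d\<close>, where minimality
      applies.\<close>
    have "inj_on r {Suc i..<Suc (i + d)}"
    proof (rule linorder_inj_onI)
      fix a b assume ab: "a < b" "a \<in> {Suc i..<Suc (i + d)}" "b \<in> {Suc i..<Suc (i + d)}"
      then show "r a \<noteq> r b"
        using min[of "b - a" a] by auto
    qed auto
    moreover have "tl (pawalk_verts (r i) (p i d)) = map r [Suc i..<Suc (i + d)]"
      unfolding verts by (simp add: upt_conv_Cons del: upt_Suc)
    ultimately show ?thesis by (simp add: distinct_map del: upt_Suc)
  qed
  moreover have "length (p i d) = d" by (simp add: p_def)
  ultimately have "cycle (p i d) \<and> length (p i d) \<ge> 3"
    using d3 by (auto simp: cycle_def)
  then show False using acyclic by blast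
qed

lemma rays_eq: "rays T = {r. nonbacktracking r}"
proof (rule equalityI; rule subsetI)
  fix r assume "r \<in> rays T"
  then show "r \<in> {r. nonbacktracking r}"
    by (auto simp: rays_def nonbacktracking_def dest: injD)
next
  fix r assume "r \<in> {r. nonbacktracking r}"
  then show "r \<in> rays T"
    using nonbacktracking_inj by (auto simp: rays_def nonbacktracking_def)
qed

lemma chain_nonbacktracking:
  assumes "\<And>i. (e i, e (Suc i)) \<in> nb_step"
  shows "nonbacktracking (\<lambda>i. fst (e i))" "\<And>i. e i = (fst (e i), fst (e (Suc i)))"
proof -
  have *: "e i \<in> parcs T" "snd (e i) = fst (e (Suc i))" "snd (e (Suc i)) \<noteq> fst (e i)" for i
    using assms[of i] by (auto simp: nb_step_def)
  then show eq: "\<And>i. e i = (fst (e i), fst (e (Suc i)))"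
    by (metis prod.collapse)
  show "nonbacktracking (\<lambda>i. fst (e i))"
    unfolding nonbacktracking_def by (metis * prod.collapse)
qed

text \<open>The rays share an arc at the joint, not just a vertex, so any three consecutive vertices
  of the new sequence lie on one of the two rays.\<close>

lemma nonbacktracking_glue:
  assumes "nonbacktracking q" "nonbacktracking r" "q m = r n" "q (Suc m) = r (Suc n)"
  shows "nonbacktracking (\<lambda>i. if i \<le> m then q i else r (i - m + n))"
  unfolding nonbacktracking_def
proof (intro allI)
  fix i
  note * = assms(1,2)[unfolded nonbacktracking_def, rule_format]
  consider "Suc i < m" | "Suc i = m" | "i = m" | k where "i = m + Suc k"
    by (metis less_imp_Suc_add linorder_neqE_nat Suc_lessI add_Suc_right)
  then show "((if i \<le> m then q i else r (i - m + n)),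
      (if Suc i \<le> m then q (Suc i) else r (Suc i - m + n))) \<in> parcs T \<and>
    (if Suc (Suc i) \<le> m then q (Suc (Suc i)) else r (Suc (Suc i) - m + n)) \<noteq>
      (if i \<le> m then q i else r (i - m + n))"
  proof cases
    case 1
    then show ?thesis using *(1)[of i] by auto
  next
    case 2
    then show ?thesis using *(1)[of i] assms(4) by auto
  next
    case 3
    then show ?thesis using *(2)[of n] assms(3) by (auto simp: Suc_diff_le)
  next
    case 4
    then show ?thesis using *(2)[of "Suc k + n"] by (auto simp: numeral_3_eq_3)
  qed
qed

end

section \<open>Branching and local finiteness\<close>

locale thick_tree = biregular_tree T V0 V1 d0 d1
  for T :: "'v pair_pre_digraph" and V0 V1 :: "'v set" and d0 d1 :: nat +
  assumes thick: "d0 \<ge> 3" "d1 \<ge> 3"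
begin

definition nbrs :: "'v \<Rightarrow> 'v set" where
  "nbrs v = {w. (v, w) \<in> parcs T}"

lemma card_nbrs: "v \<in> V0 \<Longrightarrow> card (nbrs v) = d0" "v \<in> V1 \<Longrightarrow> card (nbrs v) = d1"
proof -
  have "out_arcs (with_proj T) v = Pair v ` nbrs v"
    by (auto simp: out_arcs_def nbrs_def image_iff)
  then have "out_degree (with_proj T) v = card (nbrs v)"
    by (simp add: out_degree_def card_image inj_on_def)
  then show "v \<in> V0 \<Longrightarrow> card (nbrs v) = d0" "v \<in> V1 \<Longrightarrow> card (nbrs v) = d1"
    using degree0 degree1 by auto
qed

lemma card_nbrs_ge: "v \<in> pverts T \<Longrightarrow> card (nbrs v) \<ge> 3"
  using card_nbrs thick partition(1) by blast

lemma finite_nbrs: "finite (nbrs v)"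
proof (cases "v \<in> pverts T")
  case True
  then show ?thesis using card_nbrs_ge[of v] by (metis card.infinite not_numeral_le_zero)
next
  case False
  then have "nbrs v = {}" using in_arcsD1 by (auto simp: nbrs_def)
  then show ?thesis by simp
qed

lemma two_successors:
  assumes "(u, v) \<in> parcs T"
  shows "\<exists>w w'. w \<noteq> w' \<and> ((u, v), (v, w)) \<in> nb_step \<and> ((u, v), (v, w')) \<in> nb_step"
proof -
  have "card (nbrs v - {u}) \<ge> 2"
    using card_nbrs_ge[of v] in_arcsD2[OF assms] by (auto simp: card_Diff_singleton_if)
  then obtain w w' where "w \<in> nbrs v - {u}" "w' \<in> nbrs v - {u}" "w \<noteq> w'"
    using card_le_Suc0_iff_eq[of "nbrs v - {u}"] finite_nbrs[of v] by (auto simp: numeral_2_eq_2 not_less_eq_eq)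
  then show ?thesis using assms by (auto simp: nb_step_iff nbrs_def)
qed

text \<open>Every arc has a successor, so a finite walk continues forever. Connecting walks can thus
  be treated as rays and glued by \<open>nonbacktracking_glue\<close>.\<close>

lemma nb_walk_extend:
  assumes "(a, b) \<in> nb_step ^^ n" "b \<in> parcs T"
  obtains r where "nonbacktracking r" "a = (r 0, r 1)" "b = (r n, r (Suc n))"
proof -
  obtain f where f: "f 0 = a" "f n = b" "\<And>i. i < n \<Longrightarrow> (f i, f (Suc i)) \<in> nb_step"
    using assms(1) by (auto simp: relpow_fun_conv)
  \<comment> \<open>The clause for \<open>i = 0\<close> pins the start of the sequence, which
    dependent choice would otherwise leave free.\<close>
  have "\<exists>h. h 0 = b \<and> (\<forall>i. (h i \<in> parcs T \<and> (i = 0 \<longrightarrow> h i = b)) \<and> (h i, h (Suc i)) \<in> nb_step)"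
    using dependent_nat_choice[of "\<lambda>i x. x \<in> parcs T \<and> (i = 0 \<longrightarrow> x = b)" "\<lambda>_ x y. (x, y) \<in> nb_step"]
      assms(2) two_successors nb_step_arcs by (metis nat.simps(3) prod.collapse)
  then obtain h where h: "h 0 = b" "\<And>i. (h i, h (Suc i)) \<in> nb_step"
    by blast
  define e where "e i = (if i \<le> n then f i else h (i - n))" for i
  have e: "(e i, e (Suc i)) \<in> nb_step" for i
  proof -
    consider "i < n" | "i = n" | "i > n" by linarith
    then show ?thesis
      using f h(2)[of "i - n"] h(1) by cases (auto simp: e_def Suc_diff_le)
  qed
  show ?thesis
    using that[OF chain_nonbacktracking(1)[of e, OF e]] chain_nonbacktracking(2)[of e, OF e] f
    by (metis One_nat_def e_def le0 order_refl)
qed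

lemma finite_ball: "finite {v. (x, v) \<in> (parcs T) ^^ n}"
proof (induction n)
  case (Suc n)
  have "{v. (x, v) \<in> (parcs T) ^^ Suc n} = (\<Union>u\<in>{v. (x, v) \<in> (parcs T) ^^ n}. nbrs u)"
    by (auto simp: nbrs_def)
  then show ?case using Suc finite_nbrs by simp
qed simp

text \<open>Makes the family of sets in the Baire argument countable: there are countably many maps
  from a finite set to the vertices.\<close>

lemma countable_verts: "countable (pverts T)"
proof -
  obtain x where x: "x \<in> pverts T" using vertex_exists by blast
  have "pverts T \<subseteq> (\<Union>n. {v. (x, v) \<in> (parcs T) ^^ n})"
    using connected_rtrancl[OF x] by (auto simp: rtrancl_power)
  moreover have "countable (\<Union>n. {v. (x, v) \<in> (parcs T) ^^ n})"
    using finite_ball by (auto intro: countable_finite)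
  ultimately show ?thesis by (rule countable_subset)
qed

end

section \<open>Powers of discrete spaces\<close>

text \<open>The topology of pointwise convergence in terms of cylinders, used both for automorphisms
  and for rays, with \<open>I\<close> the vertices and the natural numbers respectively.\<close>

lemma openin_product_discrete:
  "openin (product_topology (\<lambda>_. discrete_topology D) I) U \<longleftrightarrow>
    U \<subseteq> (I \<rightarrow>\<^sub>E D) \<and>
    (\<forall>f\<in>U. \<exists>F. finite F \<and> F \<subseteq> I \<and> (\<forall>g\<in>I \<rightarrow>\<^sub>E D. (\<forall>i\<in>F. g i = f i) \<longrightarrow> g \<in> U))"
  (is "?L \<longleftrightarrow> ?R")
proof
  assume L: ?L
  have "U \<subseteq> (I \<rightarrow>\<^sub>E D)"
    using openin_subset[OF L] by simp
  moreover have "\<exists>F. finite F \<and> F \<subseteq> I \<and> (\<forall>g\<in>I \<rightarrow>\<^sub>E D. (\<forall>i\<in>F. g i = f i) \<longrightarrow> g \<in> U)"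
    if f: "f \<in> U" for f
  proof -
    obtain W where W: "finite {i \<in> I. W i \<noteq> D}" "f \<in> Pi\<^sub>E I W" "Pi\<^sub>E I W \<subseteq> U"
      using L f unfolding openin_product_topology_alt by auto
    have "g \<in> U" if "g \<in> I \<rightarrow>\<^sub>E D" "\<forall>i\<in>{i \<in> I. W i \<noteq> D}. g i = f i" for g
    proof -
      have "g i \<in> W i" if "i \<in> I" for i
        using that \<open>g \<in> I \<rightarrow>\<^sub>E D\<close> \<open>\<forall>i\<in>{i \<in> I. W i \<noteq> D}. g i = f i\<close> W(2) by (cases "W i = D") auto
      then have "g \<in> Pi\<^sub>E I W"
        using \<open>g \<in> I \<rightarrow>\<^sub>E D\<close> by (auto simp: PiE_iff)
      then show ?thesis using W(3) by blast
    qed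
    then show ?thesis using W(1) by blast
  qed
  ultimately show ?R by blast
next
  assume R: ?R
  show ?L
    unfolding openin_product_topology_alt
  proof
    fix f assume f: "f \<in> U"
    obtain F where F: "finite F" "F \<subseteq> I" "\<And>g. g \<in> I \<rightarrow>\<^sub>E D \<Longrightarrow> (\<forall>i\<in>F. g i = f i) \<Longrightarrow> g \<in> U"
      using bspec[OF conjunct2[OF R] f] by auto
    have fD: "f \<in> I \<rightarrow>\<^sub>E D" using subsetD[OF conjunct1[OF R] f] .
    let ?W = "\<lambda>i. if i \<in> F then {f i} else D"
    have "{i \<in> I. ?W i \<noteq> topspace (discrete_topology D)} \<subseteq> F" by auto
    then have "finite {i \<in> I. ?W i \<noteq> topspace (discrete_topology D)}"
      using F(1) finite_subset by blast
    moreover have "\<forall>i\<in>I. openin (discrete_topology D) (?W i)"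
      using fD by auto
    moreover have "f \<in> Pi\<^sub>E I ?W"
      using fD by (auto simp: PiE_iff)
    moreover have "Pi\<^sub>E I ?W \<subseteq> U"
    proof
      fix g assume g: "g \<in> Pi\<^sub>E I ?W"
      have "g i \<in> D" if "i \<in> I" for i
        using PiE_mem[OF g that] fD that by (auto split: if_splits)
      moreover have "\<forall>i\<in>F. g i = f i"
        using g F(2) by (fastforce simp: PiE_iff)
      moreover have "g \<in> extensional I" using g by (auto simp: PiE_iff)
      ultimately show "g \<in> U" by (intro F(3)) (auto simp: PiE_iff)
    qed
    ultimately show "\<exists>W. finite {i \<in> I. W i \<noteq> topspace (discrete_topology D)} \<and>
        (\<forall>i\<in>I. openin (discrete_topology D) (W i)) \<and> f \<in> Pi\<^sub>E I W \<and> Pi\<^sub>E I W \<subseteq> U"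
      by (intro exI[of _ ?W]) simp
  qed
qed

lemma openin_subtopology_product_discrete:
  assumes S: "S \<subseteq> (I \<rightarrow>\<^sub>E D)"
  shows "openin (subtopology (product_topology (\<lambda>_. discrete_topology D) I) S) U \<longleftrightarrow>
    U \<subseteq> S \<and> (\<forall>f\<in>U. \<exists>F. finite F \<and> F \<subseteq> I \<and> (\<forall>g\<in>S. (\<forall>i\<in>F. g i = f i) \<longrightarrow> g \<in> U))"
  (is "?L \<longleftrightarrow> ?R")
proof
  assume ?L
  then obtain W where "openin (product_topology (\<lambda>_. discrete_topology D) I) W \<and> U = W \<inter> S"
    unfolding openin_subtopology by (rule exE)
  then have W: "openin (product_topology (\<lambda>_. discrete_topology D) I) W" "U = W \<inter> S"
    by (simp_all only:)
  have "\<exists>F. finite F \<and> F \<subseteq> I \<and> (\<forall>g\<in>S. (\<forall>i\<in>F. g i = f i) \<longrightarrow> g \<in> U)" if fU: "f \<in> U" for f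
  proof -
    obtain F where "finite F" "F \<subseteq> I" "\<forall>g\<in>I \<rightarrow>\<^sub>E D. (\<forall>i\<in>F. g i = f i) \<longrightarrow> g \<in> W"
      using bspec[OF conjunct2[OF W(1)[unfolded openin_product_discrete]], of f] fU W(2) by auto
    then show ?thesis using S W(2) by (intro exI[of _ F]) auto
  qed
  then show ?R using W(2) by blast
next
  assume R: ?R
  then have US: "U \<subseteq> S" by (rule conjunct1)
  have "\<exists>F. \<forall>f\<in>U. (finite (F f) \<and> F f \<subseteq> I) \<and> (\<forall>g\<in>S. (\<forall>i\<in>F f. g i = f i) \<longrightarrow> g \<in> U)"
    using conjunct2[OF R] by (intro bchoice) simp
  then obtain F where "\<forall>f\<in>U. (finite (F f) \<and> F f \<subseteq> I) \<and>
      (\<forall>g\<in>S. (\<forall>i\<in>F f. g i = f i) \<longrightarrow> g \<in> U)"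
    by (rule exE)
  note F = bspec[OF this, THEN conjunct1] bspec[OF this, THEN conjunct2, rule_format]
  \<comment> \<open>The ambient open set is the union of the cylinders given by \<open>F f\<close>
    around the points \<open>f\<close> of \<open>U\<close>.\<close>
  let ?W = "{g \<in> I \<rightarrow>\<^sub>E D. \<exists>f\<in>U. \<forall>i\<in>F f. g i = f i}"
  have "openin (product_topology (\<lambda>_. discrete_topology D) I) ?W"
    unfolding openin_product_discrete
  proof (intro conjI ballI)
    fix g assume "g \<in> ?W"
    then obtain f where "f \<in> U" "\<forall>i\<in>F f. g i = f i" by blast
    then show "\<exists>F. finite F \<and> F \<subseteq> I \<and> (\<forall>h\<in>I \<rightarrow>\<^sub>E D. (\<forall>i\<in>F. h i = g i) \<longrightarrow> h \<in> ?W)"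
      using F(1)[of f] by (intro exI[of _ "F f"]) auto
  qed auto
  moreover have "?W \<inter> S \<subseteq> U" using F(2) by auto
  moreover have "U \<subseteq> ?W \<inter> S" using US S by auto
  ultimately show ?L
    unfolding openin_subtopology by (intro exI[of _ ?W]) auto
qed

lemma in_closure_of_product_discrete:
  assumes "f \<in> product_topology (\<lambda>_. discrete_topology D) I closure_of S" "finite F" "F \<subseteq> I"
  shows "\<exists>g\<in>S. \<forall>i\<in>F. g i = f i"
proof -
  let ?U = "{g \<in> I \<rightarrow>\<^sub>E D. \<forall>i\<in>F. g i = f i}"
  have "openin (product_topology (\<lambda>_. discrete_topology D) I) ?U"
    unfolding openin_product_discrete using assms(2,3) by auto
  moreover have "f \<in> ?U"
    using assms(1) by (auto simp: in_closure_of)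
  ultimately show ?thesis
    using assms(1)[unfolded in_closure_of, THEN conjunct2, rule_format, of ?U] by auto
qed


section \<open>Groups of automorphisms\<close>

context biregular_tree
begin

abbreviation "A \<equiv> aut_group T V0 V1"

lemma aut_carrier_iff:
  "f \<in> carrier A \<longleftrightarrow> f \<in> Bij (pverts T) \<and>
    (\<forall>u\<in>pverts T. \<forall>v\<in>pverts T. (f u, f v) \<in> parcs T \<longleftrightarrow> (u, v) \<in> parcs T) \<and>
    f ` V0 = V0 \<and> f ` V1 = V1"
  by (auto simp: aut_group_def graph_automorphisms_def)

lemma subgroup_aut: "subgroup (carrier A) (BijGroup (pverts T))"
proof (rule group.subgroupI[OF group_BijGroup])
  have V: "V0 \<subseteq> pverts T" "V1 \<subseteq> pverts T" using partition(1) by auto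
  show "carrier A \<subseteq> carrier (BijGroup (pverts T))"
    by (auto simp: aut_carrier_iff BijGroup_def)
  have "(\<lambda>x\<in>pverts T. x) \<in> carrier A"
    using V by (auto simp: aut_carrier_iff id_Bij image_iff subset_iff)
  then show "carrier A \<noteq> {}" by blast
  fix f assume f: "f \<in> carrier A"
  then have bij: "bij_betw f (pverts T) (pverts T)"
    by (auto simp: aut_carrier_iff Bij_def)
  let ?h = "restrict (inv_into (pverts T) f) (pverts T)"
  have h: "?h v \<in> pverts T" "f (?h v) = v" if "v \<in> pverts T" for v
    using bij that by (auto simp: bij_betw_def inv_into_into f_inv_into_f)
  have hf: "?h (f v) = v" if "v \<in> pverts T" for v
    using bij that by (auto simp: bij_betw_def)
  have im: "?h ` W = W" if "f ` W = W" "W \<subseteq> pverts T" for W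
  proof -
    have "?h ` (f ` W) = W"
      unfolding image_image using that(2) hf by (simp add: subset_iff)
    then show ?thesis using that(1) by simp
  qed
  have "?h \<in> carrier A"
    unfolding aut_carrier_iff
  proof (intro conjI ballI)
    show "?h \<in> Bij (pverts T)"
      using f by (intro restrict_inv_into_Bij) (auto simp: aut_carrier_iff)
    show "?h ` V0 = V0" "?h ` V1 = V1"
      using f V by (auto intro!: im simp only: aut_carrier_iff)
    fix u v assume "u \<in> pverts T" "v \<in> pverts T"
    then show "(?h u, ?h v) \<in> parcs T \<longleftrightarrow> (u, v) \<in> parcs T"
      using f h unfolding aut_carrier_iff by metis
  qed
  then show "inv\<^bsub>BijGroup (pverts T)\<^esub> f \<in> carrier A"
    using f by (simp add: inv_BijGroup aut_carrier_iff)
next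
  fix f g assume f: "f \<in> carrier A" and g: "g \<in> carrier A"
  have V: "V0 \<subseteq> pverts T" "V1 \<subseteq> pverts T" using partition(1) by auto
  have gV: "g v \<in> pverts T" if "v \<in> pverts T" for v
    using g that by (auto simp: aut_carrier_iff Bij_def bij_betw_def)
  have im: "compose (pverts T) f g ` W = W" if "W \<subseteq> pverts T" "f ` W = W" "g ` W = W" for W
  proof -
    have "compose (pverts T) f g ` W = f ` g ` W"
      using that(1) by (auto simp: compose_def image_image subset_iff)
    then show ?thesis using that by simp
  qed
  have "compose (pverts T) f g \<in> carrier A"
    using f g gV im[OF V(1)] im[OF V(2)] by (auto simp: aut_carrier_iff compose_Bij compose_eq)
  then show "f \<otimes>\<^bsub>BijGroup (pverts T)\<^esub> g \<in> carrier A"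
    using f g by (simp add: BijGroup_def aut_carrier_iff)
qed

lemma aut_group_eq: "A = (BijGroup (pverts T))\<lparr>carrier := carrier A\<rparr>"
  by (simp add: aut_group_def)

lemma group_aut: "group A"
  using subgroup.subgroup_is_group[OF subgroup_aut group_BijGroup] aut_group_eq by simp

end

sublocale biregular_tree \<subseteq> aut: group "aut_group T V0 V1"
  by (rule group_aut)

context biregular_tree
begin

lemma aut_mult: "f \<in> carrier A \<Longrightarrow> g \<in> carrier A \<Longrightarrow> v \<in> pverts T \<Longrightarrow> (f \<otimes>\<^bsub>A\<^esub> g) v = f (g v)"
  by (simp add: aut_group_def BijGroup_def graph_automorphisms_def compose_eq)

lemma aut_one: "v \<in> pverts T \<Longrightarrow> \<one>\<^bsub>A\<^esub> v = v"
  by (simp add: aut_group_def BijGroup_def)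

lemma aut_verts: "f \<in> carrier A \<Longrightarrow> v \<in> pverts T \<Longrightarrow> f v \<in> pverts T"
  by (auto simp: aut_carrier_iff Bij_def bij_betw_def)

lemma aut_inv:
  assumes f: "f \<in> carrier A" and v: "v \<in> pverts T"
  shows "(inv\<^bsub>A\<^esub> f) (f v) = v" "f ((inv\<^bsub>A\<^esub> f) v) = v"
proof -
  show "(inv\<^bsub>A\<^esub> f) (f v) = v"
    using aut_mult[OF aut.inv_closed[OF f] f v] aut.l_inv[OF f] aut_one[OF v] by simp
  show "f ((inv\<^bsub>A\<^esub> f) v) = v"
    using aut_mult[OF f aut.inv_closed[OF f] v] aut.r_inv[OF f] aut_one[OF v] by simp
qed

lemma aut_inj: "f \<in> carrier A \<Longrightarrow> u \<in> pverts T \<Longrightarrow> v \<in> pverts T \<Longrightarrow> f u = f v \<longleftrightarrow> u = v"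
  by (metis aut_inv(1))

lemma aut_arc: "f \<in> carrier A \<Longrightarrow> u \<in> pverts T \<Longrightarrow> v \<in> pverts T \<Longrightarrow>
    (f u, f v) \<in> parcs T \<longleftrightarrow> (u, v) \<in> parcs T"
  by (simp add: aut_carrier_iff)

lemma aut_type: "f \<in> carrier A \<Longrightarrow> v \<in> pverts T \<Longrightarrow> f v \<in> V0 \<longleftrightarrow> v \<in> V0"
  using partition by (auto simp: aut_carrier_iff) (metis IntI UnE empty_iff image_eqI)+

lemma aut_map_arc: "f \<in> carrier A \<Longrightarrow> a \<in> parcs T \<Longrightarrow> map_prod f f a \<in> parcs T"
  using aut_arc wellformed' by (cases a) auto

lemma aut_nb_step:
  assumes f: "f \<in> carrier A" and ab: "(a, b) \<in> nb_step"
  shows "(map_prod f f a, map_prod f f b) \<in> nb_step"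
proof -
  have "snd b \<in> pverts T" "fst a \<in> pverts T" "snd b \<noteq> fst a"
    using ab arc_fst_in_verts arc_snd_in_verts by (auto simp: nb_step_def)
  then have "f (snd b) \<noteq> f (fst a)"
    using aut_inj[OF f] by blast
  then show ?thesis
    using ab aut_map_arc[OF f] by (simp add: nb_step_def)
qed

lemma aut_nb_relpow:
  assumes "f \<in> carrier A"
  shows "(a, b) \<in> nb_step ^^ n \<Longrightarrow> (map_prod f f a, map_prod f f b) \<in> nb_step ^^ n"
proof (induction n arbitrary: b)
  case (Suc n)
  then show ?case using aut_nb_step[OF assms] by (meson relpow_Suc_E relpow_Suc_I)
qed simp

lemma aut_nonbacktracking: "f \<in> carrier A \<Longrightarrow> nonbacktracking r \<Longrightarrow> nonbacktracking (\<lambda>i. f (r i))"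
  using nonbacktracking_verts[of r] by (auto simp: nonbacktracking_def aut_arc aut_inj)

lemma aut_relpow_arcs:
  assumes "f \<in> carrier A"
  shows "(u, v) \<in> parcs T ^^ n \<Longrightarrow> (f u, f v) \<in> parcs T ^^ n"
proof (induction n arbitrary: v)
  case (Suc n)
  then obtain w where "(u, w) \<in> parcs T ^^ n" "(w, v) \<in> parcs T"
    by (meson relpow_Suc_E)
  then show ?case
    using Suc.IH aut_arc[OF assms] wellformed' by (meson relpow_Suc_I)
qed simp

lemma aut_map_mult: "f \<in> carrier A \<Longrightarrow> g \<in> carrier A \<Longrightarrow> a \<in> parcs T \<Longrightarrow>
    map_prod (f \<otimes>\<^bsub>A\<^esub> g) (f \<otimes>\<^bsub>A\<^esub> g) a = map_prod f f (map_prod g g a)"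
  by (simp add: prod_eq_iff aut_mult arc_fst_in_verts arc_snd_in_verts)

lemma aut_map_inv:
  assumes "f \<in> carrier A" "a \<in> parcs T"
  shows "map_prod (inv\<^bsub>A\<^esub> f) (inv\<^bsub>A\<^esub> f) (map_prod f f a) = a"
    "map_prod f f (map_prod (inv\<^bsub>A\<^esub> f) (inv\<^bsub>A\<^esub> f) a) = a"
  using assms by (simp_all add: prod_eq_iff aut_inv arc_fst_in_verts arc_snd_in_verts)

end

section \<open>Closed groups transitive on the boundary\<close>

text \<open>Assumes no more than a subgroup, so that it can be instantiated both at \<open>G\<close>
  and at the lattice.\<close>

locale tree_group = thick_tree T V0 V1 d0 d1
  for T :: "'v pair_pre_digraph" and V0 V1 :: "'v set" and d0 d1 :: nat +
  fixes G :: "('v \<Rightarrow> 'v) set"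
  assumes subgroup: "subgroup G (aut_group T V0 V1)"
begin

lemma in_aut [simp]: "g \<in> G \<Longrightarrow> g \<in> carrier A"
  using subgroup.subset[OF subgroup] by blast

lemma mult_closed [simp]: "g \<in> G \<Longrightarrow> h \<in> G \<Longrightarrow> g \<otimes>\<^bsub>A\<^esub> h \<in> G"
  by (rule subgroup.m_closed[OF subgroup])

lemma inv_closed [simp]: "g \<in> G \<Longrightarrow> inv\<^bsub>A\<^esub> g \<in> G"
  by (rule subgroup.m_inv_closed[OF subgroup])

lemma one_closed [simp]: "\<one>\<^bsub>A\<^esub> \<in> G"
  by (rule subgroup.one_closed[OF subgroup])

lemma group_subset_PiE: "G \<subseteq> (pverts T \<rightarrow>\<^sub>E pverts T)"
proof
  fix g assume "g \<in> G"
  then have "g \<in> Bij (pverts T)" by (auto dest: in_aut simp only: aut_carrier_iff)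
  then show "g \<in> pverts T \<rightarrow>\<^sub>E pverts T"
    by (auto simp: Bij_def bij_betw_def PiE_def)
qed

lemma subtopology_group:
  "subtopology (aut_topology T V0 V1) G =
    subtopology (product_topology (\<lambda>_. discrete_topology (pverts T)) (pverts T)) G"
proof -
  have "carrier A \<inter> G = G" using in_aut by blast
  then show ?thesis by (simp add: aut_topology_def subtopology_subtopology)
qed

lemma openin_group:
  "openin (subtopology (aut_topology T V0 V1) G) U \<longleftrightarrow> U \<subseteq> G \<and>
    (\<forall>f\<in>U. \<exists>F. finite F \<and> F \<subseteq> pverts T \<and> (\<forall>g\<in>G. (\<forall>v\<in>F. g v = f v) \<longrightarrow> g \<in> U))"
  unfolding subtopology_group by (rule openin_subtopology_product_discrete[OF group_subset_PiE])

text \<open>A walk of length \<open>n\<close> from \<open>x\<close> to \<open>v\<close> is carried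
  to one of length \<open>n\<close> starting at \<open>y\<close>, and balls are finite.\<close>

lemma finite_fibre_image:
  assumes "x \<in> pverts T" "v \<in> pverts T"
  shows "finite {g v | g. g \<in> G \<and> g x = y}"
proof -
  obtain n where n: "(x, v) \<in> parcs T ^^ n"
    using connected_rtrancl[OF assms] by (auto simp: rtrancl_power)
  have "{g v | g. g \<in> G \<and> g x = y} \<subseteq> {w. (y, w) \<in> parcs T ^^ n}"
    using aut_relpow_arcs[OF in_aut n] by auto
  then show ?thesis using finite_ball finite_subset by blast
qed

end

lemma (in thick_tree) class_in_boundary: "nonbacktracking r \<Longrightarrow> ray_rel T `` {r} \<in> tree_boundary T"
  by (auto simp: tree_boundary_def rays_eq intro: quotientI)

lemma (in thick_tree) self_in_class: "nonbacktracking r \<Longrightarrow> r \<in> ray_rel T `` {r}"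
  by (auto simp: ray_rel_def rays_eq)

text \<open>Equality of ends only says that tails agree after shifts \<open>m\<close> and
  \<open>n\<close>, which are not under control.\<close>

lemma (in tree_group) transitive_rays:
  assumes "transitive_on_boundary T G" "nonbacktracking t" "nonbacktracking q"
  shows "\<exists>g\<in>G. \<exists>m n. \<forall>i. q (m + i) = g (t (n + i))"
proof -
  obtain g where g: "g \<in> G" "boundary_action g (ray_rel T `` {t}) = ray_rel T `` {q}"
    using assms class_in_boundary by (auto simp: transitive_on_boundary_def) blast
  have "g \<circ> t \<in> ray_rel T `` {q}"
    using g(2) self_in_class[OF assms(2)] by (auto simp: boundary_action_def)
  then show ?thesis using g(1) by (auto simp: ray_rel_def)
qed

locale closed_tree_group = tree_group T V0 V1 d0 d1 G
  for T :: "'v pair_pre_digraph" and V0 V1 :: "'v set" and d0 d1 :: nat and G :: "('v \<Rightarrow> 'v) set" +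
  assumes closed: "closedin (aut_topology T V0 V1) G"
begin

text \<open>Each vertex has finitely many images under elements sending \<open>x\<close> to
  \<open>y\<close>, so the set lies in a product of finite sets, compact by Tychonoff. It remains to
  see that it is closed among all maps.\<close>

lemma compactin_fibre:
  assumes x: "x \<in> pverts T"
  shows "compactin (aut_topology T V0 V1) {g \<in> G. g x = y}"
proof -
  let ?P = "product_topology (\<lambda>_. discrete_topology (pverts T)) (pverts T)"
  define S where "S = {g \<in> G. g x = y}"
  define B where "B v = {g v | g. g \<in> S}" for v
  have SG: "S \<subseteq> G" by (auto simp: S_def)
  have aut_carr: "g \<in> carrier A" if "g \<in> S" for g using that SG by auto
  have finB: "finite (B v)" if "v \<in> pverts T" for v
    using finite_fibre_image[OF x that, of y] by (simp add: B_def S_def)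
  have BV: "B v \<subseteq> pverts T" if "v \<in> pverts T" for v
    using that aut_verts aut_carr by (auto simp: B_def)
  have "compactin (discrete_topology (pverts T)) (B v)" if "v \<in> pverts T" for v
    using finite_imp_compactin[of "B v" "discrete_topology (pverts T)"] finB[OF that] BV[OF that] by simp
  then have "compactin ?P (Pi\<^sub>E (pverts T) B)"
    unfolding compactin_PiE by blast
  moreover have "S \<subseteq> Pi\<^sub>E (pverts T) B"
  proof
    fix g assume g: "g \<in> S"
    then have "g \<in> pverts T \<rightarrow>\<^sub>E pverts T" using SG group_subset_PiE by blast
    then show "g \<in> Pi\<^sub>E (pverts T) B" using g by (simp add: B_def PiE_iff) blast
  qed
  moreover have "closedin ?P S"
  proof (rule closure_of_subset_eq[THEN iffD1], intro conjI subsetI)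
    show "f \<in> topspace ?P" if "f \<in> S" for f
      using that SG group_subset_PiE by auto
    fix f assume f: "f \<in> ?P closure_of S"
    note approx = in_closure_of_product_discrete[OF f]
    have f_ext: "f \<in> pverts T \<rightarrow>\<^sub>E pverts T"
      using f by (auto simp: in_closure_of)
    have fV: "f v \<in> pverts T" if "v \<in> pverts T" for v
      using f_ext that by auto
    have two: "\<exists>g\<in>S. g u = f u \<and> g v = f v" if "u \<in> pverts T" "v \<in> pverts T" for u v
      using approx[of "{u, v}"] that by auto
    have arc: "(f u, f v) \<in> parcs T \<longleftrightarrow> (u, v) \<in> parcs T" if "u \<in> pverts T" "v \<in> pverts T" for u v
      using two[OF that] aut_arc[OF aut_carr that] by metis
    have inj: "f u = f v \<longleftrightarrow> u = v" if "u \<in> pverts T" "v \<in> pverts T" for u v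
      using two[OF that] aut_inj[OF aut_carr that] by metis
    have ty: "f v \<in> V0 \<longleftrightarrow> v \<in> V0" if "v \<in> pverts T" for v
      using two[OF that that] aut_type[OF aut_carr that] by metis
    \<comment> \<open>A pointwise limit of bijections need not be onto. Approximating
      \<open>f\<close> at \<open>v\<close> and all its finitely many neighbours by a single
      \<open>g\<close> gives preimages to the neighbours of \<open>f v\<close>; connectedness then
      spreads this from \<open>f x\<close>.\<close>
    have nbr: "w \<in> f ` pverts T" if v: "v \<in> pverts T" and w: "(f v, w) \<in> parcs T" for v w
    proof -
      have sub: "insert v (nbrs v) \<subseteq> pverts T"
        using v in_arcsD2 by (auto simp: nbrs_def)
      obtain g where g: "g \<in> S" "\<forall>u\<in>insert v (nbrs v). g u = f u"
        using approx[OF _ sub] finite_nbrs by blast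
      let ?u = "(inv\<^bsub>A\<^esub> g) w"
      have wV: "w \<in> pverts T" using w in_arcsD2 by blast
      have uV: "?u \<in> pverts T" using aut_verts[OF aut.inv_closed[OF aut_carr[OF g(1)]] wV] .
      have "g ?u = w" using aut_inv(2)[OF aut_carr[OF g(1)] wV] .
      then have "(v, ?u) \<in> parcs T"
        using w g(2) aut_arc[OF aut_carr[OF g(1)] v uV] by auto
      then have "f ?u = w" using g(2) \<open>g ?u = w\<close> by (auto simp: nbrs_def)
      then show ?thesis using uV by (intro image_eqI[of w f ?u]) simp_all
    qed
    have surj: "w \<in> f ` pverts T" if "w \<in> pverts T" for w
    proof -
      have "(f x, w) \<in> (parcs T)\<^sup>*" using connected_rtrancl fV x that by blast
      then show ?thesis
        by (induction rule: rtrancl_induct) (use x nbr in auto)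
    qed
    have img: "f ` pverts T = pverts T" using surj fV by blast
    have "f ` V0 = V0" "f ` V1 = V1"
    proof -
      have "w \<in> f ` V0" if "w \<in> V0" for w
        using surj[of w] that ty partition(1) by blast
      moreover have "w \<in> f ` V1" if "w \<in> V1" for w
        using surj[of w] that ty partition by blast
      moreover have "f v \<in> V0" if "v \<in> V0" for v using ty that partition(1) by blast
      moreover have "f v \<in> V1" if "v \<in> V1" for v
        using ty[of v] fV[of v] that partition by blast
      ultimately show "f ` V0 = V0" "f ` V1 = V1" by blast+
    qed
    moreover have "f \<in> Bij (pverts T)"
      using f_ext img inj by (auto simp: Bij_def PiE_def bij_betw_def inj_on_def)
    ultimately have fA: "f \<in> carrier A"
      using arc by (simp add: aut_carrier_iff)
    have "carrier A \<inter> S = S" using aut_carr by blast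
    \<comment> \<open>\<open>G\<close> is closed relative to \<open>aut_topology\<close>, so
      \<open>f\<close> had to be recognised as an automorphism first.\<close>
    then have "f \<in> aut_topology T V0 V1 closure_of S"
      using f fA by (simp add: aut_topology_def closure_of_subtopology)
    then have "f \<in> G"
      using closure_of_minimal[OF SG closed] by blast
    moreover have "f x = y"
      using two[OF x x] by (auto simp: S_def)
    ultimately show "f \<in> S" by (simp add: S_def)
  qed
  ultimately have "compactin ?P S"
    by (rule closed_compactin)
  moreover have "S \<subseteq> carrier A" using aut_carr by blast
  ultimately have "compactin (aut_topology T V0 V1) S"
    by (simp add: aut_topology_def compactin_subtopology)
  then show ?thesis by (simp add: S_def)
qed

text \<open>A finite orbit would make \<open>G\<close> a finite union of the compact sets of
  \<open>compactin_fibre\<close>.\<close>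

lemma infinite_vertex_orbit:
  assumes "\<not> compactin (aut_topology T V0 V1) G" and x: "x \<in> pverts T"
  shows "infinite {g x | g. g \<in> G}"
proof
  assume "finite {g x | g. g \<in> G}"
  moreover have "G = (\<Union>y\<in>{g x | g. g \<in> G}. {g \<in> G. g x = y})" by blast
  ultimately show False
    using assms(1) compactin_fibre[OF x]
    by (metis (no_types, lifting) compactin_Union finite_imageI imageE)
qed

text \<open>
  The rays are covered by the countably many sets \<open>K \<phi> m n\<close>, which are closed because vertex
  stabilizers are compact; by Baire's theorem one of them contains a cylinder, and a cylinder
  around \<open>t\<close> can be moved into it.
\<close>

lemma open_ray_orbit:
  assumes trans: "transitive_on_boundary T G"
    and F: "finite F" "F \<subseteq> pverts T" "F \<noteq> {}"
    and t: "nonbacktracking t"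
  shows "\<exists>N. \<forall>q. nonbacktracking q \<longrightarrow> (\<forall>i\<le>N. q i = t i) \<longrightarrow>
    (\<exists>k\<in>G. (\<forall>v\<in>F. k v = v) \<and> (\<forall>i\<ge>N. q i = k (t i)))"
proof -
  obtain x where x: "x \<in> F" "x \<in> pverts T" using F by blast
  let ?P = "product_topology (\<lambda>_. discrete_topology (pverts T)) (UNIV :: nat set)"
  define \<Omega> where "\<Omega> = {q. nonbacktracking q}"
  define X where "X = subtopology ?P \<Omega>"
  have \<Omega>_sub: "\<Omega> \<subseteq> (UNIV \<rightarrow>\<^sub>E pverts T)"
    using nonbacktracking_verts by (auto simp: \<Omega>_def PiE_iff)
  have openX: "openin X U \<longleftrightarrow> U \<subseteq> \<Omega> \<and>
      (\<forall>f\<in>U. \<exists>F. finite F \<and> (\<forall>g\<in>\<Omega>. (\<forall>i\<in>F. g i = f i) \<longrightarrow> g \<in> U))" for U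
    unfolding X_def openin_subtopology_product_discrete[OF \<Omega>_sub] by simp
  have topX: "topspace X = \<Omega>"
    using \<Omega>_sub by (auto simp: X_def)
  have "closedin ?P \<Omega>"
  proof -
    have "openin ?P ((UNIV \<rightarrow>\<^sub>E pverts T) - \<Omega>)"
      unfolding openin_product_discrete
    proof (intro conjI ballI)
      fix f assume "f \<in> (UNIV \<rightarrow>\<^sub>E pverts T) - \<Omega>"
      then obtain n where n: "\<not> ((f n, f (Suc n)) \<in> parcs T \<and> f (Suc (Suc n)) \<noteq> f n)"
        by (auto simp: \<Omega>_def nonbacktracking_def)
      have "g \<notin> \<Omega>" if "g n = f n" "g (Suc n) = f (Suc n)" "g (Suc (Suc n)) = f (Suc (Suc n))" for g
      proof
        assume "g \<in> \<Omega>"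
        then have "(g n, g (Suc n)) \<in> parcs T \<and> g (Suc (Suc n)) \<noteq> g n"
          by (simp add: \<Omega>_def nonbacktracking_def)
        then show False using n that by simp
      qed
      then show "\<exists>F. finite F \<and> F \<subseteq> UNIV \<and>
          (\<forall>g\<in>UNIV \<rightarrow>\<^sub>E pverts T. (\<forall>i\<in>F. g i = f i) \<longrightarrow> g \<in> (UNIV \<rightarrow>\<^sub>E pverts T) - \<Omega>)"
        by (intro exI[of _ "{n, Suc n, Suc (Suc n)}"] conjI ballI impI) simp_all
    qed blast
    then show ?thesis
      using \<Omega>_sub by (simp add: closedin_def)
  qed
  moreover have "completely_metrizable_space ?P"
    by (simp add: completely_metrizable_space_product_topology
        completely_metrizable_space_discrete_topology)
  ultimately have cm: "completely_metrizable_space X"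
    unfolding X_def by (rule completely_metrizable_space_closedin[rotated])
  \<comment> \<open>The index \<open>\<phi>\<close> records the values on \<open>F\<close>: elements
    with the same \<open>\<phi>\<close> differ by an element fixing \<open>F\<close>, which is how
    \<open>k\<close> arises below.\<close>
  define K where "K \<phi> m n = {q \<in> \<Omega>. \<exists>g\<in>G. restrict g F = \<phi> \<and> (\<forall>i. q (m + i) = g (t (n + i)))}"
    for \<phi> :: "'v \<Rightarrow> 'v" and m n :: nat
  define \<Phi> where "\<Phi> = (\<lambda>g. restrict g F) ` G"
  have "\<Phi> \<subseteq> (F \<rightarrow>\<^sub>E pverts T)"
    using F(2) aut_verts by (auto simp: \<Phi>_def)
  moreover have "countable (F \<rightarrow>\<^sub>E pverts T)"
    by (intro countable_PiE F(1) countable_verts)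
  ultimately have "countable \<Phi>" by (rule countable_subset)
  then have "countable ((\<lambda>(\<phi>, m, n). K \<phi> m n) ` (\<Phi> \<times> UNIV \<times> UNIV))"
    by auto
  moreover have "closedin X (K \<phi> m n)" if "\<phi> \<in> \<Phi>" for \<phi> m n
    unfolding closedin_def topX openX
  proof (intro conjI ballI)
    show "K \<phi> m n \<subseteq> \<Omega>" by (auto simp: K_def)
    fix q assume q: "q \<in> \<Omega> - K \<phi> m n"
    define S where "S = {g \<in> G. g x = \<phi> x}"
    \<comment> \<open>The \<open>C j\<close> are decreasing closed subsets of the compact
      \<open>S\<close>. Were all of them nonempty, a common element would put \<open>q\<close> into
      \<open>K \<phi> m n\<close>; so finitely many values of \<open>q\<close> already exclude
      it.\<close>
    define C where "C j = {g \<in> S. restrict g F = \<phi> \<and> (\<forall>i\<le>j. q (m + i) = g (t (n + i)))}" for j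
    have SP: "S \<subseteq> (pverts T \<rightarrow>\<^sub>E pverts T)" using group_subset_PiE by (auto simp: S_def)
    have "carrier A \<inter> S = S" by (auto simp: S_def)
    then have sub: "subtopology (aut_topology T V0 V1) S =
        subtopology (product_topology (\<lambda>_. discrete_topology (pverts T)) (pverts T)) S"
      by (simp add: aut_topology_def subtopology_subtopology)
    have top: "topspace (subtopology (aut_topology T V0 V1) S) = S"
      using \<open>carrier A \<inter> S = S\<close> by auto
    have "\<exists>j. C j = {}"
    proof (rule ccontr)
      assume "\<nexists>j. C j = {}"
      then have ne: "\<And>j. C j \<noteq> {}" by blast
      have comp: "compact_space (subtopology (aut_topology T V0 V1) S)"
        using compactin_fibre[OF x(2)] by (simp add: S_def compactin_subspace)
      have "closedin (subtopology (aut_topology T V0 V1) S) (C j)" for j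
        unfolding closedin_def top unfolding sub openin_subtopology_product_discrete[OF SP]
      proof (intro conjI ballI)
        show "C j \<subseteq> S" by (auto simp: C_def)
        fix f assume f: "f \<in> S - C j"
        show "\<exists>F. finite F \<and> F \<subseteq> pverts T \<and> (\<forall>g\<in>S. (\<forall>i\<in>F. g i = f i) \<longrightarrow> g \<in> S - C j)"
        proof (intro exI[of _ "F \<union> (\<lambda>i. t (n + i)) ` {..j}"] conjI ballI impI)
          show "F \<union> (\<lambda>i. t (n + i)) ` {..j} \<subseteq> pverts T"
            using F nonbacktracking_verts[OF t] by auto
          fix g assume g: "g \<in> S" "\<forall>i\<in>F \<union> (\<lambda>i. t (n + i)) ` {..j}. g i = f i"
          then have "restrict g F = restrict f F" "\<forall>i\<le>j. g (t (n + i)) = f (t (n + i))"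
            by (auto simp: restrict_def)
          then show "g \<in> S - C j" using f g(1) by (auto simp: C_def)
        qed (use F in auto)
      qed auto
      then have "\<Inter> (range C) \<noteq> {}"
        by (intro compact_space_imp_nest[OF comp] ne) (auto simp: C_def antimono_def)
      then obtain g where "\<And>j. g \<in> C j" by blast
      then have "g \<in> G" "restrict g F = \<phi>" "\<forall>i. q (m + i) = g (t (n + i))"
        by (auto simp: C_def S_def)
      then show False using q by (auto simp: K_def)
    qed
    then obtain j where j: "C j = {}" by blast
    have "q' \<in> \<Omega> - K \<phi> m n" if q': "q' \<in> \<Omega>" "\<forall>i\<in>{..m + j}. q' i = q i" for q'
    proof -
      have False if g: "g \<in> G" "restrict g F = \<phi>" "\<forall>i. q' (m + i) = g (t (n + i))" for g
      proof -
        have "g x = \<phi> x" using g(2) x(1) by auto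
        moreover have "\<forall>i\<le>j. q (m + i) = g (t (n + i))"
          using g(3) q'(2) by (metis add_le_cancel_left atMost_iff)
        ultimately have "g \<in> C j" using g by (auto simp: C_def S_def)
        then show False using j by simp
      qed
      then show ?thesis using q'(1) by (auto simp: K_def)
    qed
    then show "\<exists>F. finite F \<and> (\<forall>g\<in>\<Omega>. (\<forall>i\<in>F. g i = q i) \<longrightarrow> g \<in> \<Omega> - K \<phi> m n)"
      by (intro exI[of _ "{..m + j}"]) auto
  qed auto
  moreover have "\<Union> ((\<lambda>(\<phi>, m, n). K \<phi> m n) ` (\<Phi> \<times> UNIV \<times> UNIV)) = \<Omega>"
  proof
    show "\<Omega> \<subseteq> \<Union> ((\<lambda>(\<phi>, m, n). K \<phi> m n) ` (\<Phi> \<times> UNIV \<times> UNIV))"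
    proof
      fix q assume q: "q \<in> \<Omega>"
      then obtain g m n where "g \<in> G" "\<forall>i. q (m + i) = g (t (n + i))"
        using transitive_rays[OF trans t, of q] unfolding \<Omega>_def by blast
      then have "q \<in> K (restrict g F) m n" "restrict g F \<in> \<Phi>"
        using q by (auto simp: K_def \<Phi>_def)
      then show "q \<in> \<Union> ((\<lambda>(\<phi>, m, n). K \<phi> m n) ` (\<Phi> \<times> UNIV \<times> UNIV))"
        by force
    qed
  qed (auto simp: K_def)
  moreover have "X interior_of \<Omega> \<noteq> {}"
  proof -
    have "X interior_of \<Omega> = \<Omega>"
      by (metis interior_of_topspace topX)
    then show ?thesis using t by (auto simp: \<Omega>_def)
  qed
  ultimately have "\<exists>\<phi>\<in>\<Phi>. \<exists>m n. X interior_of K \<phi> m n \<noteq> {}"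
    using Baire_category_alt[of X "(\<lambda>(\<phi>, m, n). K \<phi> m n) ` (\<Phi> \<times> UNIV \<times> UNIV)"] cm
    by (smt (verit, ccfv_SIG) SigmaE case_prod_conv imageE)
  then obtain \<phi> m n q0 where "q0 \<in> X interior_of K \<phi> m n" by blast
  then obtain U where U: "openin X U" "q0 \<in> U" "U \<subseteq> K \<phi> m n"
    by (auto simp: interior_of_def)
  obtain F' where F': "finite F'" "\<And>q. q \<in> \<Omega> \<Longrightarrow> \<forall>i\<in>F'. q i = q0 i \<Longrightarrow> q \<in> U"
    using bspec[OF openX[THEN iffD1, OF U(1), THEN conjunct2] U(2)] by auto
  \<comment> \<open>Beyond all coordinates that determine membership in \<open>U\<close>, and at
    least \<open>m\<close>, so that \<open>q0 M\<close> lies on the part of \<open>q0\<close> that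
    is a translate of \<open>t\<close>.\<close>
  define M where "M = Max (insert m F')"
  have M: "m \<le> M" "\<And>i. i \<in> F' \<Longrightarrow> i \<le> M"
    using F'(1) by (auto simp: M_def)
  have q0: "nonbacktracking q0" "q0 \<in> K \<phi> m n"
    using U by (auto simp: openX \<Omega>_def)
  then obtain g0 where g0: "g0 \<in> G" "restrict g0 F = \<phi>" "\<And>i. q0 (m + i) = g0 (t (n + i))"
    by (auto simp: K_def)
  \<comment> \<open>Chosen so that \<open>q0 M = g0 (t N)\<close>: here \<open>q0\<close> can be
    left for \<open>g0\<close> applied to \<open>q\<close>. The bound below is \<open>Suc N\<close>
    because gluing needs agreement on an arc.\<close>
  define N where "N = n + M - m"
  have "\<exists>k\<in>G. (\<forall>v\<in>F. k v = v) \<and> (\<forall>i\<ge>Suc N. q i = k (t i))"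
    if q: "nonbacktracking q" "\<forall>i\<le>Suc N. q i = t i" for q
  proof -
    define p where "p i = (if i \<le> M then q0 i else g0 (q (i - M + N)))" for i
    have "q0 M = g0 (q N)"
      using g0(3)[of "M - m"] M(1) q(2) by (simp add: N_def)
    moreover have "q0 (Suc M) = g0 (q (Suc N))"
      using g0(3)[of "Suc M - m"] M(1) q(2) by (simp add: N_def Suc_diff_le)
    ultimately have "nonbacktracking p"
      unfolding p_def using nonbacktracking_glue[OF q0(1) aut_nonbacktracking[OF in_aut[OF g0(1)] q(1)]]
      by simp
    then have "p \<in> K \<phi> m n"
      using F'(2)[of p] M(2) U(3) by (auto simp: \<Omega>_def p_def)
    then obtain g1 where g1: "g1 \<in> G" "restrict g1 F = \<phi>" "\<And>i. p (m + i) = g1 (t (n + i))"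
      by (auto simp: K_def)
    let ?k = "inv\<^bsub>A\<^esub> g0 \<otimes>\<^bsub>A\<^esub> g1"
    have "?k v = v" if "v \<in> F" for v
    proof -
      have "g1 v = g0 v" using g1(2) g0(2) that by (metis restrict_apply')
      then show ?thesis using that F(2) g0(1) g1(1) aut_inv(1)[of g0 v] by (auto simp: aut_mult)
    qed
    moreover have "q i = ?k (t i)" if "i \<ge> Suc N" for i
    proof -
      have "p (m + (i - n)) = g0 (q i)"
        using that M(1) by (auto simp: p_def N_def)
      then have "g0 (q i) = g1 (t i)"
        using g1(3)[of "i - n"] that M(1) by (simp add: N_def)
      then show ?thesis
        using g0(1) g1(1) nonbacktracking_verts[OF t] nonbacktracking_verts[OF q(1)]
          aut_inv(1)[of g0 "q i"] by (simp add: aut_mult)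
    qed
    ultimately show ?thesis using g0(1) g1(1) by (intro bexI[of _ ?k]) auto
  qed
  then show ?thesis by blast
qed

end

lemma relpow_trans: "(a, b) \<in> R ^^ m \<Longrightarrow> (b, c) \<in> R ^^ n \<Longrightarrow> (a, c) \<in> R ^^ (m + n)"
  by (auto simp: relpow_add)

text \<open>Dependent choice for rays. It serves two uses of Koenig's lemma, with \<open>Q\<close>
  saying that infinitely many orbit points lie ahead, and with \<open>Q\<close> saying that an arc
  is not accessible.\<close>

lemma (in undirected_tree) dependent_ray:
  assumes "Q a" "\<And>a. Q a \<Longrightarrow> \<exists>b. (a, b) \<in> S \<and> Q b" "S \<subseteq> nb_step"
  obtains r where "nonbacktracking r" "a = (r 0, r 1)" "\<And>i. Q (r i, r (Suc i))"
    "\<And>i. ((r i, r (Suc i)), (r (Suc i), r (Suc (Suc i)))) \<in> S"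
proof -
  have "\<exists>e. \<forall>i. (Q (e i) \<and> (i = 0 \<longrightarrow> e i = a)) \<and> (e i, e (Suc i)) \<in> S"
  proof (rule dependent_nat_choice)
    show "\<exists>x. Q x \<and> (0 = (0::nat) \<longrightarrow> x = a)" using assms(1) by blast
    fix x and n :: nat assume "Q x \<and> (n = 0 \<longrightarrow> x = a)"
    then obtain y where "(x, y) \<in> S" "Q y" using assms(2) by blast
    then show "\<exists>y. (Q y \<and> (Suc n = 0 \<longrightarrow> y = a)) \<and> (x, y) \<in> S" by (intro exI[of _ y]) simp
  qed
  then obtain e where e: "\<And>i. Q (e i)" "e 0 = a" "\<And>i. (e i, e (Suc i)) \<in> S"
    by blast
  then have st: "(e i, e (Suc i)) \<in> nb_step" for i using assms(3) by blast
  note eq = chain_nonbacktracking(2)[of e, OF st]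
  have "Q (fst (e i), fst (e (Suc i)))" for i using e(1)[of i] eq[of i] by simp
  moreover have "((fst (e i), fst (e (Suc i))), (fst (e (Suc i)), fst (e (Suc (Suc i))))) \<in> S" for i
    using e(3)[of i] eq[of i] eq[of "Suc i"] by simp
  moreover have "a = (fst (e 0), fst (e 1))" using eq[of 0] e(2) by simp
  ultimately show ?thesis
    using that[OF chain_nonbacktracking(1)[of e, OF st]] by simp
qed

section \<open>Cocompactness of the group\<close>

context closed_tree_group
begin

text \<open>By Koenig's lemma some ray \<open>\<rho>\<close> has orbit points of \<open>x\<close>
  ahead of each of its arcs. A tail of \<open>r\<close> is a translate of a tail of
  \<open>\<rho>\<close>, so orbit points lie ahead of \<open>r\<close> too; a ray that follows
  \<open>r\<close> and then visits one of them is moved back onto \<open>r\<close> by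
  \<open>open_ray_orbit\<close>.\<close>

lemma returning_ray:
  assumes trans: "transitive_on_boundary T G"
    and inf: "infinite {g x | g. g \<in> G}"
    and r: "nonbacktracking r" "r 0 = x"
  shows "\<exists>l>0. \<exists>g\<in>G. r l = g x"
proof -
  let ?O = "{g x | g. g \<in> G}"
  have x: "x \<in> pverts T" using nonbacktracking_verts[OF r(1), of 0] r(2) by simp
  have OV: "y \<in> pverts T" if "y \<in> ?O" for y using that aut_verts x by auto
  have O_act: "g y \<in> ?O" if "g \<in> G" "y \<in> ?O" for g y
  proof -
    obtain h where h: "h \<in> G" "y = h x" using \<open>y \<in> ?O\<close> by blast
    then have "g y = (g \<otimes>\<^bsub>A\<^esub> h) x" using that(1) x by (simp add: aut_mult)
    then show ?thesis using mult_closed[OF that(1) h(1)] by blast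
  qed
  \<comment> \<open>The orbit points ahead of the arc \<open>a\<close>.\<close>
  define B where "B a = {y \<in> ?O. \<exists>u. (a, (u, y)) \<in> nb_step\<^sup>*}" for a
  have "?O - {x} \<subseteq> (\<Union>x'\<in>nbrs x. B (x, x'))"
  proof
    fix y assume y: "y \<in> ?O - {x}"
    then obtain x' y' where "(x, x') \<in> parcs T" "((x, x'), (y', y)) \<in> nb_step\<^sup>*"
      using nb_walk_exists[OF x OV[of y]] by auto
    then show "y \<in> (\<Union>x'\<in>nbrs x. B (x, x'))"
      using y by (auto simp: B_def nbrs_def)
  qed
  moreover have "infinite (?O - {x})" using inf by simp
  ultimately have "\<exists>x'\<in>nbrs x. infinite (B (x, x'))"
    using finite_nbrs finite_subset by blast
  then obtain x' where x': "(x, x') \<in> parcs T" "infinite (B (x, x'))"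
    by (auto simp: nbrs_def)
  have ext: "\<exists>b. (a, b) \<in> nb_step \<and> infinite (B b)" if a: "infinite (B a)" for a
  proof (rule ccontr)
    assume *: "\<not> ?thesis"
    have "B a \<subseteq> insert (snd a) (\<Union>b\<in>nb_step `` {a}. B b)"
    proof
      fix y assume "y \<in> B a"
      then obtain u where u: "y \<in> ?O" "(a, (u, y)) \<in> nb_step\<^sup>*" by (auto simp: B_def)
      from u(2) show "y \<in> insert (snd a) (\<Union>b\<in>nb_step `` {a}. B b)"
        by (cases rule: converse_rtranclE) (use u(1) in \<open>auto simp: B_def\<close>)
    qed
    moreover have "nb_step `` {a} \<subseteq> Pair (snd a) ` nbrs (snd a)"
      by (auto simp: nb_step_def nbrs_def)
    then have "finite (nb_step `` {a})"
      using finite_nbrs finite_subset by blast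
    ultimately show False using * a finite_subset by blast
  qed
  obtain \<rho> where \<rho>: "nonbacktracking \<rho>" "\<And>i. infinite (B (\<rho> i, \<rho> (Suc i)))"
    by (rule dependent_ray[of "\<lambda>a. infinite (B a)" "(x, x')" nb_step]) (use x' ext in auto)
  obtain N where N: "\<And>q. nonbacktracking q \<Longrightarrow> \<forall>i\<le>N. q i = r i \<Longrightarrow>
      \<exists>k\<in>G. (\<forall>v\<in>{x}. k v = v) \<and> (\<forall>i\<ge>N. q i = k (r i))"
    using open_ray_orbit[OF trans, of "{x}" r] x r(1) by auto
  obtain g m n where g: "g \<in> G" "\<And>i. r (m + i) = g (\<rho> (n + i))"
    using transitive_rays[OF trans \<rho>(1) r(1)] by blast
  have "B (\<rho> (n + N), \<rho> (Suc (n + N))) \<noteq> {}"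
    using \<rho>(2)[of "n + N"] by (metis finite.emptyI)
  then obtain y u j where y: "y \<in> ?O" "((\<rho> (n + N), \<rho> (Suc (n + N))), (u, y)) \<in> nb_step ^^ j"
    by (auto simp: B_def rtrancl_power)
  have "((r (m + N), r (Suc (m + N))), (g u, g y)) \<in> nb_step ^^ j"
    using aut_nb_relpow[OF in_aut[OF g(1)] y(2)] g(2)[of N] g(2)[of "Suc N"] by simp
  \<comment> \<open>The walk is prefixed by the part of \<open>r\<close> between \<open>N\<close>
    and \<open>m + N\<close>, so that it starts at the index from which \<open>r\<close> may be
    modified.\<close>
  then have "((r N, r (Suc N)), (g u, g y)) \<in> nb_step ^^ (m + j)"
    using relpow_trans[OF nonbacktracking_relpow[OF r(1), of N m]] by (simp add: add.commute)
  then obtain i where i: "((r N, r (Suc N)), (g u, g y)) \<in> nb_step ^^ i" by blast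
  moreover have "(r N, r (Suc N)) \<in> parcs T"
    using r(1) by (simp add: nonbacktracking_def)
  ultimately obtain p where p: "nonbacktracking p" "(r N, r (Suc N)) = (p 0, p 1)"
      "(g u, g y) = (p i, p (Suc i))"
    using nb_walk_extend nb_relpow_arcs by metis
  define q where "q l = (if l \<le> N then r l else p (l - N + 0))" for l
  have "nonbacktracking q"
    unfolding q_def using p(2) by (intro nonbacktracking_glue r(1) p(1)) auto
  then obtain k where k: "k \<in> G" "\<And>l. l \<ge> N \<Longrightarrow> q l = k (r l)"
    using N[of q] by (auto simp: q_def)
  have "k (r (N + Suc i)) = g y"
    using k(2)[of "N + Suc i"] p(3) by (simp add: q_def)
  then have "r (N + Suc i) = (inv\<^bsub>A\<^esub> k) (g y)"
    using aut_inv(1)[OF in_aut[OF k(1)] nonbacktracking_verts[OF r(1), of "N + Suc i"]] by simp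
  moreover have "(inv\<^bsub>A\<^esub> k) (g y) \<in> ?O"
    by (rule O_act[OF inv_closed[OF k(1)] O_act[OF g(1) y(1)]])
  ultimately show ?thesis by (intro exI[of _ "N + Suc i"]) auto
qed

text \<open>
  By Koenig's lemma only finitely many arcs can be reached from \<open>x\<close> before returning to the orbit
  of \<open>x\<close>.
\<close>

lemma finitely_many_vertex_orbits:
  assumes trans: "transitive_on_boundary T G"
    and noncompact: "\<not> compactin (aut_topology T V0 V1) G"
  shows "\<exists>D. finite D \<and> D \<subseteq> pverts T \<and> (\<forall>v\<in>pverts T. \<exists>g\<in>G. g v \<in> D)"
proof -
  obtain x where x: "x \<in> pverts T" using vertex_exists by blast
  define O1 where "O1 = {g x | g. g \<in> G}"
  have inf: "infinite O1"
    using infinite_vertex_orbit[OF noncompact x] by (simp add: O1_def)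
  \<comment> \<open>Steps that stop as soon as the head of the arc is in the orbit of
    \<open>x\<close>.\<close>
  define S where "S = {(a, b) \<in> nb_step. snd a \<notin> O1}"
  have fin_succ: "finite (S `` {a})" for a
  proof -
    have "S `` {a} \<subseteq> Pair (snd a) ` nbrs (snd a)"
      by (auto simp: S_def nb_step_def nbrs_def)
    then show ?thesis using finite_nbrs finite_subset by blast
  qed
  \<comment> \<open>Koenig's lemma in well-founded form: from a non-accessible arc one can step in
    \<open>S\<close> forever, which gives a ray from \<open>x\<close> that never returns to
    \<open>O1\<close>.\<close>
  have acc: "(x, x') \<in> Wellfounded.acc (S\<inverse>)" for x'
  proof (rule ccontr)
    assume "(x, x') \<notin> Wellfounded.acc (S\<inverse>)"
    moreover have "\<exists>b. (a, b) \<in> S \<and> b \<notin> Wellfounded.acc (S\<inverse>)" if "a \<notin> Wellfounded.acc (S\<inverse>)" for a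
      using that by (meson accI converse_iff)
    moreover have "S \<subseteq> nb_step" by (auto simp: S_def)
    ultimately obtain r where r: "nonbacktracking r" "(x, x') = (r 0, r 1)"
        "\<And>i. ((r i, r (Suc i)), (r (Suc i), r (Suc (Suc i)))) \<in> S"
      using dependent_ray[of "\<lambda>a. a \<notin> Wellfounded.acc (S\<inverse>)" "(x, x')" S] by metis
    have "r 0 = x" using r(2) by simp
    then obtain l g where "l > 0" "g \<in> G" "r l = g x"
      using returning_ray[OF trans inf[unfolded O1_def] r(1)] by metis
    then have l: "l > 0" "r l \<in> O1" unfolding O1_def by blast+
    \<comment> \<open>The arc with index \<open>l - 1\<close> ends at \<open>r l\<close>, so the
      step from it is not in \<open>S\<close>.\<close>
    then show False using r(3)[of "l - 1"] by (simp add: S_def)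
  qed
  have fin_acc: "finite {b. (a, b) \<in> S\<^sup>*}" if "a \<in> Wellfounded.acc (S\<inverse>)" for a
    using that
  proof (induction rule: acc_induct_rule)
    case (1 a)
    have "{b. (a, b) \<in> S\<^sup>*} \<subseteq> insert a (\<Union>c\<in>S `` {a}. {b. (c, b) \<in> S\<^sup>*})"
      by (auto elim: converse_rtranclE)
    then show ?case
      by (rule finite_subset) (use 1 fin_succ in simp)
  qed
  define R where "R = (\<Union>x'\<in>nbrs x. {b. ((x, x'), b) \<in> S\<^sup>*})"
  have finR: "finite R"
    unfolding R_def using finite_nbrs fin_acc[OF acc] by blast
  have start: "a \<in> R" if "fst a = x" "a \<in> parcs T" for a
    using that by (cases a) (auto simp: R_def nbrs_def)
  \<comment> \<open>Whenever the head of the arc is in \<open>O1\<close>, a translation makes the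
    next arc start at \<open>x\<close>, where \<open>R\<close> contains every arc.\<close>
  have cover: "\<exists>g\<in>G. map_prod g g b \<in> R"
    if "((x, x'), b) \<in> nb_step\<^sup>*" "(x, x') \<in> parcs T" for x' b
    using that(1)
  proof (induction rule: rtrancl_induct)
    case base
    have "map_prod \<one>\<^bsub>A\<^esub> \<one>\<^bsub>A\<^esub> (x, x') \<in> R"
      using that(2) aut_one in_arcsD1 in_arcsD2 by (auto simp: R_def nbrs_def)
    then show ?case using one_closed by blast
  next
    case (step b c)
    then obtain g where g: "g \<in> G" "map_prod g g b \<in> R" by blast
    have st: "(map_prod g g b, map_prod g g c) \<in> nb_step"
      using aut_nb_step[OF in_aut[OF g(1)] step.hyps(2)] .
    show ?case
    proof (cases "snd (map_prod g g b) \<in> O1")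
      case False
      then have "(map_prod g g b, map_prod g g c) \<in> S" using st by (auto simp: S_def)
      then have "map_prod g g c \<in> R"
        using g(2) by (auto simp: R_def intro: rtrancl.rtrancl_into_rtrancl)
      then show ?thesis using g(1) by blast
    next
      case True
      then obtain h where h: "h \<in> G" "fst (map_prod g g c) = h x"
        using st by (auto simp: O1_def nb_step_def)
      let ?k = "inv\<^bsub>A\<^esub> h \<otimes>\<^bsub>A\<^esub> g"
      have c: "c \<in> parcs T" using step.hyps(2) nb_step_arcs by blast
      have "fst (map_prod ?k ?k c) = x"
        using h aut_inv(1)[OF in_aut[OF h(1)] x] g(1) arc_fst_in_verts[OF c] by (simp add: aut_mult)
      moreover have "map_prod ?k ?k c \<in> parcs T"
        using aut_map_arc[OF in_aut c, of ?k] g(1) h(1) by simp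
      ultimately have "map_prod ?k ?k c \<in> R"
        by (intro start)
      then show ?thesis using g(1) h(1) by (intro bexI[of _ ?k]) auto
    qed
  qed
  let ?D = "insert x (snd ` R) \<inter> pverts T"
  have "\<exists>g\<in>G. g v \<in> ?D" if v: "v \<in> pverts T" for v
  proof (cases "v = x")
    case True
    then show ?thesis using aut_one[OF x] x one_closed by (intro bexI[of _ "\<one>\<^bsub>A\<^esub>"]) auto
  next
    case False
    then obtain x' y' where "(x, x') \<in> parcs T" "((x, x'), (y', v)) \<in> nb_step\<^sup>*"
      using nb_walk_exists[OF x v] by auto
    then obtain g where "g \<in> G" "map_prod g g (y', v) \<in> R" using cover by blast
    then have "g v \<in> snd ` R" "g \<in> G" by force+
    then show ?thesis using aut_verts[OF in_aut v] by blast
  qed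
  then show ?thesis using finR by (intro exI[of _ ?D]) auto
qed

end

section \<open>Recurrence of non-backtracking walks modulo a lattice\<close>

text \<open>Discreteness and cocompactness in the form needed for counting: finite stabilizers and
  finitely many arc orbits.\<close>

locale uniform_tree_group = tree_group T V0 V1 d0 d1 \<Gamma>
  for T :: "'v pair_pre_digraph" and V0 V1 :: "'v set" and d0 d1 :: nat and \<Gamma> :: "('v \<Rightarrow> 'v) set" +
  assumes finite_fibre: "x \<in> pverts T \<Longrightarrow> finite {\<gamma> \<in> \<Gamma>. \<gamma> x = y}"
    and finite_quotient: "\<exists>D. finite D \<and> D \<subseteq> parcs T \<and> (\<forall>a\<in>parcs T. \<exists>\<gamma>\<in>\<Gamma>. map_prod \<gamma> \<gamma> a \<in> D)"
begin

abbreviation act :: "('v \<Rightarrow> 'v) \<Rightarrow> 'v \<times> 'v \<Rightarrow> 'v \<times> 'v" where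
  "act \<gamma> \<equiv> map_prod \<gamma> \<gamma>"

definition arc_orbit :: "'v \<times> 'v \<Rightarrow> ('v \<times> 'v) set" where
  "arc_orbit a = (\<lambda>\<gamma>. act \<gamma> a) ` \<Gamma>"

text \<open>Chosen from the orbit as a set, so arcs with the same orbit have the same
  representative.\<close>

definition arc_rep :: "'v \<times> 'v \<Rightarrow> 'v \<times> 'v" where
  "arc_rep a = (SOME b. b \<in> arc_orbit a)"

definition stab_card :: "'v \<times> 'v \<Rightarrow> nat" where
  "stab_card d = card {\<gamma> \<in> \<Gamma>. act \<gamma> d = d}"

text \<open>Counts group elements rather than arcs: every successor of \<open>a\<close> in the orbit
  of \<open>d\<close> contributes \<open>stab_card d\<close>. Outgoing and incoming steps can then
  be compared by inverting group elements.\<close>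

definition step_count :: "'v \<times> 'v \<Rightarrow> 'v \<times> 'v \<Rightarrow> nat" where
  "step_count a d = card {\<gamma> \<in> \<Gamma>. (a, act \<gamma> d) \<in> nb_step}"

lemma act_arc: "\<gamma> \<in> \<Gamma> \<Longrightarrow> a \<in> parcs T \<Longrightarrow> act \<gamma> a \<in> parcs T"
  by (rule aut_map_arc) simp

lemma act_mult: "\<gamma> \<in> \<Gamma> \<Longrightarrow> \<delta> \<in> \<Gamma> \<Longrightarrow> a \<in> parcs T \<Longrightarrow> act (\<gamma> \<otimes>\<^bsub>A\<^esub> \<delta>) a = act \<gamma> (act \<delta> a)"
  by (rule aut_map_mult) simp_all

lemma act_one: "a \<in> parcs T \<Longrightarrow> act \<one>\<^bsub>A\<^esub> a = a"
  by (simp add: prod_eq_iff aut_one arc_fst_in_verts arc_snd_in_verts)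

lemma act_inv:
  assumes "\<gamma> \<in> \<Gamma>" "a \<in> parcs T"
  shows "act (inv\<^bsub>A\<^esub> \<gamma>) (act \<gamma> a) = a" "act \<gamma> (act (inv\<^bsub>A\<^esub> \<gamma>) a) = a"
  using assms by (simp_all add: aut_map_inv)

lemma orbit_subset: "a \<in> parcs T \<Longrightarrow> arc_orbit a \<subseteq> parcs T"
  using act_arc unfolding arc_orbit_def by blast

lemma orbit_self: "a \<in> parcs T \<Longrightarrow> a \<in> arc_orbit a"
  unfolding arc_orbit_def by (rule image_eqI[where x = "\<one>\<^bsub>A\<^esub>"]) (simp_all only: act_one one_closed)

lemma orbit_mono:
  assumes a: "a \<in> parcs T" and b: "b \<in> arc_orbit a"
  shows "arc_orbit b \<subseteq> arc_orbit a"
proof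
  fix c assume "c \<in> arc_orbit b"
  then obtain \<gamma> \<delta> where "\<gamma> \<in> \<Gamma>" "\<delta> \<in> \<Gamma>" "b = act \<gamma> a" "c = act \<delta> b"
    using b unfolding arc_orbit_def by blast
  then have "\<delta> \<otimes>\<^bsub>A\<^esub> \<gamma> \<in> \<Gamma>" "c = act (\<delta> \<otimes>\<^bsub>A\<^esub> \<gamma>) a"
    using a by (simp_all add: act_mult)
  then show "c \<in> arc_orbit a" unfolding arc_orbit_def by blast
qed

lemma orbit_eq:
  assumes a: "a \<in> parcs T" and b: "b \<in> arc_orbit a"
  shows "arc_orbit b = arc_orbit a"
proof
  show "arc_orbit b \<subseteq> arc_orbit a" by (rule orbit_mono[OF a b])
  obtain \<gamma> where g: "\<gamma> \<in> \<Gamma>" "b = act \<gamma> a" using b unfolding arc_orbit_def by blast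
  then have "a = act (inv\<^bsub>A\<^esub> \<gamma>) b" using a by (simp add: act_inv)
  then have "a \<in> arc_orbit b" unfolding arc_orbit_def using inv_closed[OF g(1)] by blast
  then show "arc_orbit a \<subseteq> arc_orbit b"
    using orbit_mono orbit_subset[OF a] b by blast
qed

lemma arc_rep_in_orbit: "a \<in> parcs T \<Longrightarrow> arc_rep a \<in> arc_orbit a"
  unfolding arc_rep_def by (rule someI) (rule orbit_self)

lemma arc_rep_eq: "a \<in> parcs T \<Longrightarrow> b \<in> arc_orbit a \<Longrightarrow> arc_rep b = arc_rep a"
  by (simp only: arc_rep_def orbit_eq[of a b])

lemma arc_rep_arc: "a \<in> parcs T \<Longrightarrow> arc_rep a \<in> parcs T"
  using arc_rep_in_orbit orbit_subset by blast

lemma finite_reps: "finite (arc_rep ` parcs T)"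
proof -
  obtain D where D: "finite D" "D \<subseteq> parcs T" "\<And>a. a \<in> parcs T \<Longrightarrow> \<exists>\<gamma>\<in>\<Gamma>. act \<gamma> a \<in> D"
    using finite_quotient by blast
  have "arc_rep a \<in> arc_rep ` D" if a: "a \<in> parcs T" for a
  proof -
    obtain \<gamma> where "\<gamma> \<in> \<Gamma>" "act \<gamma> a \<in> D" using D(3)[OF a] by blast
    then have "arc_rep (act \<gamma> a) = arc_rep a"
      by (intro arc_rep_eq[OF a]) (simp add: arc_orbit_def)
    then show ?thesis using \<open>act \<gamma> a \<in> D\<close> by (metis imageI)
  qed
  then show ?thesis using D(1) by (meson finite_imageI finite_subset image_subsetI)
qed

lemma orbit_rep_iff:
  assumes "d \<in> arc_rep ` parcs T" "b \<in> parcs T"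
  shows "b \<in> arc_orbit d \<longleftrightarrow> arc_rep b = d"
proof
  obtain c where c: "c \<in> parcs T" "d = arc_rep c" using assms(1) by blast
  have d: "d \<in> parcs T" "arc_rep d = d"
    using c arc_rep_arc arc_rep_eq[OF c(1) arc_rep_in_orbit[OF c(1)]] by auto
  show "b \<in> arc_orbit d \<Longrightarrow> arc_rep b = d"
    using arc_rep_eq[OF d(1)] d(2) by simp
  assume "arc_rep b = d"
  then have "d \<in> arc_orbit b" using arc_rep_in_orbit[OF assms(2)] by simp
  then have "arc_orbit d = arc_orbit b" by (rule orbit_eq[OF assms(2)])
  then show "b \<in> arc_orbit d" using orbit_self[OF assms(2)] by simp
qed

lemma finite_act_fibre:
  assumes "d \<in> parcs T"
  shows "finite {\<gamma> \<in> \<Gamma>. act \<gamma> d = b}"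
  by (rule finite_subset[OF _ finite_fibre[OF arc_fst_in_verts[OF assms], of "fst b"]]) auto

lemma stab_card_pos:
  assumes "d \<in> parcs T"
  shows "stab_card d > 0"
  unfolding stab_card_def card_gt_0_iff
  using finite_act_fibre[OF assms, of d] act_one[OF assms] one_closed by blast

text \<open>The fibre is the left coset by \<open>\<delta>\<close> of the stabilizer of
  \<open>d\<close>.\<close>

lemma card_act_fibre:
  assumes d: "d \<in> parcs T" and \<delta>: "\<delta> \<in> \<Gamma>"
  shows "card {\<gamma> \<in> \<Gamma>. act \<gamma> d = act \<delta> d} = stab_card d"
proof -
  have "bij_betw (\<lambda>\<gamma>. \<delta> \<otimes>\<^bsub>A\<^esub> \<gamma>) {\<gamma> \<in> \<Gamma>. act \<gamma> d = d} {\<gamma> \<in> \<Gamma>. act \<gamma> d = act \<delta> d}"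
  proof (rule bij_betw_byWitness[where f' = "\<lambda>\<gamma>. inv\<^bsub>A\<^esub> \<delta> \<otimes>\<^bsub>A\<^esub> \<gamma>"])
    show "\<forall>\<gamma>\<in>{\<gamma> \<in> \<Gamma>. act \<gamma> d = d}. inv\<^bsub>A\<^esub> \<delta> \<otimes>\<^bsub>A\<^esub> (\<delta> \<otimes>\<^bsub>A\<^esub> \<gamma>) = \<gamma>"
      using \<delta> by (auto simp: aut.m_assoc[symmetric])
    show "\<forall>\<gamma>\<in>{\<gamma> \<in> \<Gamma>. act \<gamma> d = act \<delta> d}. \<delta> \<otimes>\<^bsub>A\<^esub> (inv\<^bsub>A\<^esub> \<delta> \<otimes>\<^bsub>A\<^esub> \<gamma>) = \<gamma>"
      using \<delta> by (auto simp: aut.m_assoc[symmetric])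
    show "(\<lambda>\<gamma>. \<delta> \<otimes>\<^bsub>A\<^esub> \<gamma>) ` {\<gamma> \<in> \<Gamma>. act \<gamma> d = d} \<subseteq> {\<gamma> \<in> \<Gamma>. act \<gamma> d = act \<delta> d}"
      using \<delta> d by (auto simp: act_mult simp del: map_prod_simp)
    show "(\<lambda>\<gamma>. inv\<^bsub>A\<^esub> \<delta> \<otimes>\<^bsub>A\<^esub> \<gamma>) ` {\<gamma> \<in> \<Gamma>. act \<gamma> d = act \<delta> d} \<subseteq> {\<gamma> \<in> \<Gamma>. act \<gamma> d = d}"
      using \<delta> d by (auto simp: act_mult act_inv simp del: map_prod_simp)
  qed
  then show ?thesis by (simp add: stab_card_def bij_betw_same_card)
qed

lemma card_act_into:
  assumes d: "d \<in> parcs T" and B: "finite B"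
  shows "card {\<gamma> \<in> \<Gamma>. act \<gamma> d \<in> B} = card (B \<inter> arc_orbit d) * stab_card d"
proof -
  have "{\<gamma> \<in> \<Gamma>. act \<gamma> d \<in> B} = (\<Union>b\<in>B \<inter> arc_orbit d. {\<gamma> \<in> \<Gamma>. act \<gamma> d = b})"
    by (auto simp: arc_orbit_def)
  also have "card \<dots> = (\<Sum>b\<in>B \<inter> arc_orbit d. card {\<gamma> \<in> \<Gamma>. act \<gamma> d = b})"
    by (rule card_UN_disjoint) (use B finite_act_fibre[OF d] in auto)
  also have "\<dots> = (\<Sum>b\<in>B \<inter> arc_orbit d. stab_card d)"
    by (rule sum.cong) (use card_act_fibre[OF d] in \<open>auto simp: arc_orbit_def\<close>)
  finally show ?thesis by simp
qed

lemma nb_step_act: "\<gamma> \<in> \<Gamma> \<Longrightarrow> (a, b) \<in> nb_step \<Longrightarrow> (act \<gamma> a, act \<gamma> b) \<in> nb_step"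
  by (rule aut_nb_step) simp_all

lemma succ_eq: "(u, v) \<in> parcs T \<Longrightarrow> nb_step `` {(u, v)} = Pair v ` (nbrs v - {u})"
  by (auto simp: nb_step_iff nbrs_def)

lemma pred_eq: "(u, v) \<in> parcs T \<Longrightarrow> nb_step\<inverse> `` {(u, v)} = (\<lambda>w. (w, u)) ` (nbrs u - {v})"
  by (auto simp: nb_step_iff nbrs_def arc_commute)

lemma card_succ: "(u, v) \<in> parcs T \<Longrightarrow> card (nb_step `` {(u, v)}) = card (nbrs v) - 1"
  by (simp add: succ_eq card_image inj_on_def card_Diff_singleton_if nbrs_def arc_commute)

lemma card_pred: "(u, v) \<in> parcs T \<Longrightarrow> card (nb_step\<inverse> `` {(u, v)}) = card (nbrs u) - 1"
  by (simp add: pred_eq card_image inj_on_def nbrs_def)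

lemma finite_succ: "a \<in> parcs T \<Longrightarrow> finite (nb_step `` {a})"
  using finite_nbrs by (cases a) (simp add: succ_eq)

lemma finite_pred: "a \<in> parcs T \<Longrightarrow> finite (nb_step\<inverse> `` {a})"
  using finite_nbrs by (cases a) (simp add: pred_eq)

lemma arc_type: "(u, v) \<in> parcs T \<Longrightarrow> u \<in> V0 \<longleftrightarrow> v \<notin> V0"
  using bipartite[of u v] partition in_arcsD2[of u v] by blast

lemma card_nbrs_eq:
  assumes "u \<in> pverts T" "v \<in> pverts T" "u \<in> V0 \<longleftrightarrow> v \<in> V0"
  shows "card (nbrs u) = card (nbrs v)"
  using assms card_nbrs partition(1) by (metis UnE)

lemma step_count_succ:
  assumes "a \<in> parcs T" "d \<in> parcs T"
  shows "step_count a d = card (nb_step `` {a} \<inter> arc_orbit d) * stab_card d"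
  unfolding step_count_def using card_act_into[OF assms(2) finite_succ[OF assms(1)]] by simp

text \<open>Inverting \<open>\<gamma>\<close> moves \<open>d\<close> instead of \<open>a\<close>, so
  predecessors of \<open>a\<close> in the orbit of \<open>d\<close> are counted, and the
  multiplicity is again that of \<open>d\<close>.\<close>

lemma step_count_pred:
  assumes a: "a \<in> parcs T" and d: "d \<in> parcs T"
  shows "step_count d a = card (nb_step\<inverse> `` {a} \<inter> arc_orbit d) * stab_card d"
proof -
  have "bij_betw (\<lambda>\<gamma>. inv\<^bsub>A\<^esub> \<gamma>) {\<gamma> \<in> \<Gamma>. (d, act \<gamma> a) \<in> nb_step} {\<gamma> \<in> \<Gamma>. (act \<gamma> d, a) \<in> nb_step}"
  proof (rule bij_betw_byWitness[where f' = "\<lambda>\<gamma>. inv\<^bsub>A\<^esub> \<gamma>"])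
    show "(\<lambda>\<gamma>. inv\<^bsub>A\<^esub> \<gamma>) ` {\<gamma> \<in> \<Gamma>. (d, act \<gamma> a) \<in> nb_step} \<subseteq> {\<gamma> \<in> \<Gamma>. (act \<gamma> d, a) \<in> nb_step}"
    proof (rule image_subsetI)
      fix \<gamma> assume "\<gamma> \<in> {\<gamma> \<in> \<Gamma>. (d, act \<gamma> a) \<in> nb_step}"
      then have g: "\<gamma> \<in> \<Gamma>" "(d, act \<gamma> a) \<in> nb_step" by auto
      have "(act (inv\<^bsub>A\<^esub> \<gamma>) d, a) \<in> nb_step"
        using nb_step_act[OF inv_closed[OF g(1)] g(2)] act_inv(1)[OF g(1) a] by simp
      then show "inv\<^bsub>A\<^esub> \<gamma> \<in> {\<gamma> \<in> \<Gamma>. (act \<gamma> d, a) \<in> nb_step}" using g(1) by simp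
    qed
    show "(\<lambda>\<gamma>. inv\<^bsub>A\<^esub> \<gamma>) ` {\<gamma> \<in> \<Gamma>. (act \<gamma> d, a) \<in> nb_step} \<subseteq> {\<gamma> \<in> \<Gamma>. (d, act \<gamma> a) \<in> nb_step}"
    proof (rule image_subsetI)
      fix \<gamma> assume "\<gamma> \<in> {\<gamma> \<in> \<Gamma>. (act \<gamma> d, a) \<in> nb_step}"
      then have g: "\<gamma> \<in> \<Gamma>" "(act \<gamma> d, a) \<in> nb_step" by auto
      have "(d, act (inv\<^bsub>A\<^esub> \<gamma>) a) \<in> nb_step"
        using nb_step_act[OF inv_closed[OF g(1)] g(2)] act_inv(1)[OF g(1) d] by simp
      then show "inv\<^bsub>A\<^esub> \<gamma> \<in> {\<gamma> \<in> \<Gamma>. (d, act \<gamma> a) \<in> nb_step}" using g(1) by simp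
    qed
  qed auto
  then have "step_count d a = card {\<gamma> \<in> \<Gamma>. act \<gamma> d \<in> nb_step\<inverse> `` {a}}"
    by (simp add: step_count_def bij_betw_same_card)
  then show ?thesis using card_act_into[OF d finite_pred[OF a]] by simp
qed

lemma card_orbit_partition:
  assumes "finite B" "B \<subseteq> parcs T" "finite D" "D \<subseteq> arc_rep ` parcs T"
    "\<And>b. b \<in> B \<Longrightarrow> arc_rep b \<in> D"
  shows "(\<Sum>d\<in>D. card (B \<inter> arc_orbit d)) = card B"
proof -
  have cover: "B = (\<Union>d\<in>D. B \<inter> arc_orbit d)"
  proof
    show "B \<subseteq> (\<Union>d\<in>D. B \<inter> arc_orbit d)"
    proof
      fix b assume b: "b \<in> B"
      then have "b \<in> arc_orbit (arc_rep b)"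
        using orbit_rep_iff[of "arc_rep b" b] assms by blast
      then show "b \<in> (\<Union>d\<in>D. B \<inter> arc_orbit d)" using b assms(5) by blast
    qed
  qed blast
  have disj: "card (\<Union>d\<in>D. B \<inter> arc_orbit d) = (\<Sum>d\<in>D. card (B \<inter> arc_orbit d))"
  proof (rule card_UN_disjoint)
    show "\<forall>d\<in>D. \<forall>e\<in>D. d \<noteq> e \<longrightarrow> (B \<inter> arc_orbit d) \<inter> (B \<inter> arc_orbit e) = {}"
    proof (intro ballI impI)
      fix d e assume de: "d \<in> D" "e \<in> D" "d \<noteq> e"
      have "arc_rep b = d \<and> arc_rep b = e" if "b \<in> (B \<inter> arc_orbit d) \<inter> (B \<inter> arc_orbit e)" for b
        using that orbit_rep_iff[of d b] orbit_rep_iff[of e b] de assms(2,4) by blast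
      then show "(B \<inter> arc_orbit d) \<inter> (B \<inter> arc_orbit e) = {}" using de(3) by blast
    qed
  qed (use assms in auto)
  show ?thesis
    unfolding disj[symmetric] by (rule arg_cong[where f = card, OF cover[symmetric]])
qed

text \<open>
  Weighting an arc by the inverse order of its stabilizer turns the walk modulo the group into a
  circulation on a finite graph, so no flow can enter a set which no flow leaves.
\<close>

lemma predecessor_closed:
  assumes R: "R \<subseteq> parcs T"
    and R_act: "\<And>\<gamma> a. \<gamma> \<in> \<Gamma> \<Longrightarrow> a \<in> R \<Longrightarrow> act \<gamma> a \<in> R"
    and R_step: "\<And>a b. a \<in> R \<Longrightarrow> (a, b) \<in> nb_step \<Longrightarrow> b \<in> R"
    and ba: "(b, a) \<in> nb_step" "a \<in> R"
  shows "b \<in> R"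
proof (rule ccontr)
  assume bR: "b \<notin> R"
  have orbit_R: "c \<in> R" if "c \<in> arc_orbit d" "d \<in> R" for c d
    using that R_act unfolding arc_orbit_def by blast
  have rep_R: "arc_rep c \<in> R \<longleftrightarrow> c \<in> R" if "c \<in> parcs T" for c
  proof
    show "c \<in> R \<Longrightarrow> arc_rep c \<in> R" using orbit_R arc_rep_in_orbit[OF that] by blast
    have "c \<in> arc_orbit (arc_rep c)" using orbit_rep_iff[of "arc_rep c" c] that by blast
    then show "arc_rep c \<in> R \<Longrightarrow> c \<in> R" using orbit_R by blast
  qed
  define D where "D = arc_rep ` parcs T"
  \<comment> \<open>\<open>D\<close> represents all arc orbits, \<open>E\<close> those inside
    \<open>R\<close>.\<close>
  define E where "E = D \<inter> R"
  have finD: "finite D" "finite E" using finite_reps by (auto simp: D_def E_def)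
  have DT: "d \<in> parcs T" if "d \<in> D" for d using that arc_rep_arc by (auto simp: D_def)
  have ET: "d \<in> parcs T" if "d \<in> E" for d using that DT by (auto simp: E_def)
  define w where "w d = 1 / real (stab_card d)" for d
  have w_pos: "w d > 0" if "d \<in> D" for d
    using stab_card_pos[OF DT[OF that]] by (simp add: w_def)
  \<comment> \<open>In-degree and out-degree of an arc differ if \<open>d0 \<noteq> d1\<close>, and
    \<open>c\<close> balances them: a predecessor of \<open>(u, v)\<close> starts at a vertex of the
    type of \<open>v\<close>, so its in-degree is the out-degree of \<open>(u, v)\<close>.\<close>
  define c where "c a = real (card (nb_step\<inverse> `` {a}))" for a
  have c_pos: "c d > 0" if "d \<in> D" for d
  proof (cases d)
    case (Pair u v)
    then show ?thesis
      using card_pred[of u v] DT[OF that] card_nbrs_ge[of u] in_arcsD1[of u v] by (simp add: c_def)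
  qed
  \<comment> \<open>Summing over \<open>E\<close> is enough here, since successors of arcs in
    \<open>R\<close> stay in \<open>R\<close>; predecessors, in contrast, range over all of
    \<open>D\<close>.\<close>
  have out: "(\<Sum>d\<in>E. real (step_count a d) * w d) = real (card (nb_step `` {a}))" if a: "a \<in> E" for a
  proof -
    have "(\<Sum>d\<in>E. real (step_count a d) * w d) = (\<Sum>d\<in>E. real (card (nb_step `` {a} \<inter> arc_orbit d)))"
    proof (rule sum.cong)
      fix d assume "d \<in> E"
      then show "real (step_count a d) * w d = real (card (nb_step `` {a} \<inter> arc_orbit d))"
        using step_count_succ[OF ET[OF a] ET[of d]] stab_card_pos[OF ET[of d]] by (simp add: w_def)
    qed simp
    also have "\<dots> = real (\<Sum>d\<in>E. card (nb_step `` {a} \<inter> arc_orbit d))" by simp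
    also have "(\<Sum>d\<in>E. card (nb_step `` {a} \<inter> arc_orbit d)) = card (nb_step `` {a})"
    proof (rule card_orbit_partition)
      show "nb_step `` {a} \<subseteq> parcs T" using nb_step_arcs by blast
      show "E \<subseteq> arc_rep ` parcs T" by (auto simp: E_def D_def)
      fix b assume "b \<in> nb_step `` {a}"
      then have ab: "(a, b) \<in> nb_step" by simp
      have "a \<in> R" using a by (simp add: E_def)
      then have "b \<in> R" using ab by (rule R_step)
      moreover have bT: "b \<in> parcs T" using nb_step_arcs[OF ab] by simp
      ultimately show "arc_rep b \<in> E"
        unfolding E_def D_def using rep_R[OF bT] by simp
    qed (use finite_succ[OF ET[OF a]] finD in auto)
    finally show ?thesis .
  qed
  have inn: "(\<Sum>d\<in>D. c d * (real (step_count d a) * w d)) = c a * real (card (nb_step `` {a}))"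
    if a: "a \<in> E" for a
  proof -
    have aT: "a \<in> parcs T" by (rule ET[OF a])
    have "(\<Sum>d\<in>D. c d * (real (step_count d a) * w d)) =
        (\<Sum>d\<in>D. real (card (nb_step `` {a})) * real (card (nb_step\<inverse> `` {a} \<inter> arc_orbit d)))"
    proof (rule sum.cong)
      fix d assume d: "d \<in> D"
      have "real (step_count d a) * w d = real (card (nb_step\<inverse> `` {a} \<inter> arc_orbit d))"
        using step_count_pred[OF aT DT[OF d]] stab_card_pos[OF DT[OF d]] by (simp add: w_def)
      moreover have "c d = real (card (nb_step `` {a}))" if eM: "e \<in> nb_step\<inverse> `` {a} \<inter> arc_orbit d" for e
      proof -
        obtain u v where uv: "a = (u, v)" by (cases a)
        obtain w where e: "e = (w, u)" "(w, u) \<in> parcs T"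
          using eM uv by (cases e) (simp add: nb_step_iff)
        have "e \<in> arc_orbit d" using eM by (rule IntD2)
        then obtain \<gamma> where \<gamma>: "\<gamma> \<in> \<Gamma>" "e = act \<gamma> d" unfolding arc_orbit_def by (rule imageE)
        obtain x y where xy: "d = (x, y)" by (cases d)
        have xyT: "(x, y) \<in> parcs T" using DT[OF d] xy by simp
        have "w \<in> V0 \<longleftrightarrow> v \<in> V0"
          using arc_type[OF e(2)] arc_type[of u v] aT uv by simp
        moreover have "w = \<gamma> x" using \<gamma> e(1) xy by simp
        then have "w \<in> V0 \<longleftrightarrow> x \<in> V0" using aut_type[OF in_aut[OF \<gamma>(1)]] in_arcsD1[OF xyT] by simp
        ultimately have "card (nbrs x) = card (nbrs v)"
          using card_nbrs_eq[of x v] in_arcsD1[OF xyT] in_arcsD2[of u v] aT uv by simp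
        then show ?thesis
          using card_pred[OF xyT] card_succ[of u v] aT uv xy by (simp add: c_def)
      qed
      ultimately show "c d * (real (step_count d a) * w d) =
          real (card (nb_step `` {a})) * real (card (nb_step\<inverse> `` {a} \<inter> arc_orbit d))"
        by (cases "nb_step\<inverse> `` {a} \<inter> arc_orbit d = {}") auto
    qed simp
    also have "\<dots> = real (card (nb_step `` {a})) * real (\<Sum>d\<in>D. card (nb_step\<inverse> `` {a} \<inter> arc_orbit d))"
      by (simp add: sum_distrib_left)
    also have "(\<Sum>d\<in>D. card (nb_step\<inverse> `` {a} \<inter> arc_orbit d)) = card (nb_step\<inverse> `` {a})"
    proof (rule card_orbit_partition)
      show pT: "nb_step\<inverse> `` {a} \<subseteq> parcs T" using nb_step_arcs by blast
      show "D \<subseteq> arc_rep ` parcs T" by (simp add: D_def)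
      fix b assume "b \<in> nb_step\<inverse> `` {a}"
      then show "arc_rep b \<in> D" using pT unfolding D_def by (intro imageI) (rule subsetD)
    qed (use finite_pred[OF aT] finD in auto)
    finally show ?thesis by (simp add: c_def)
  qed
  \<comment> \<open>The flow from the orbit of \<open>a\<close> to the orbit of
    \<open>d\<close>.\<close>
  define M where "M a d = c a * (real (step_count a d) * w d) * w a" for a d
  \<comment> \<open>At each arc inflow equals outflow. So the total inflow of \<open>E\<close> is
    its total outflow, which ends in \<open>E\<close>, and nothing is left for the flow from
    \<open>D - E\<close>.\<close>
  have "(\<Sum>a\<in>E. \<Sum>d\<in>D. M d a) = (\<Sum>a\<in>E. \<Sum>d\<in>E. M d a)"
  proof -
    have "(\<Sum>a\<in>E. \<Sum>d\<in>D. M d a) = (\<Sum>a\<in>E. (\<Sum>d\<in>D. c d * (real (step_count d a) * w d)) * w a)"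
      unfolding sum_distrib_right M_def by (intro sum.cong refl) (simp add: mult_ac)
    also have "\<dots> = (\<Sum>a\<in>E. (c a * (\<Sum>d\<in>E. real (step_count a d) * w d)) * w a)"
      by (rule sum.cong) (simp_all only: inn out)
    also have "\<dots> = (\<Sum>a\<in>E. \<Sum>d\<in>E. M a d)"
      by (simp only: M_def sum_distrib_left sum_distrib_right)
    also have "\<dots> = (\<Sum>a\<in>E. \<Sum>d\<in>E. M d a)"
      by (rule sum.swap)
    finally show ?thesis .
  qed
  moreover have "(\<Sum>d\<in>D. M d a) = (\<Sum>d\<in>E. M d a) + (\<Sum>d\<in>D - E. M d a)" for a
    using sum.subset_diff[of E D "\<lambda>d. M d a"] finD by (simp add: E_def add.commute)
  ultimately have zero: "(\<Sum>a\<in>E. \<Sum>d\<in>D - E. M d a) = 0"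
    by (simp add: sum.distrib)
  have M_nn: "M d a \<ge> 0" if "d \<in> D" "a \<in> D" for d a
    using c_pos[OF that(1)] w_pos[OF that(1)] w_pos[OF that(2)] by (simp add: M_def)
  have aT: "a \<in> parcs T" and bT: "b \<in> parcs T" using ba(1) nb_step_arcs by blast+
  define a' where "a' = arc_rep a"
  define b' where "b' = arc_rep b"
  have a': "a' \<in> E" unfolding a'_def E_def D_def using rep_R[OF aT] ba(2) aT by simp
  have b': "b' \<in> D - E" unfolding b'_def E_def D_def using rep_R[OF bT] bR bT by simp
  have a'D: "a' \<in> D" and b'D: "b' \<in> D" using a' b' by (auto simp: E_def)
  have zero': "(\<Sum>d\<in>D - E. M d a') = 0"
  proof (rule sum_nonneg_eq_0_iff[THEN iffD1, THEN bspec, OF _ _ zero a'])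
    show "0 \<le> (\<Sum>d\<in>D - E. M d a)" if "a \<in> E" for a
      by (rule sum_nonneg) (use M_nn that in \<open>simp add: E_def\<close>)
  qed (rule finD)
  have "M b' a' = 0"
  proof (rule sum_nonneg_eq_0_iff[THEN iffD1, THEN bspec, OF _ _ zero' b'])
    show "0 \<le> M d a'" if "d \<in> D - E" for d using M_nn[OF _ a'D] that by simp
  qed (use finD in simp)
  then have N0: "step_count b' a' = 0"
    using c_pos[OF b'D] w_pos[OF b'D] w_pos[OF a'D] by (simp add: M_def)
  \<comment> \<open>The step from \<open>b\<close> to \<open>a\<close>, carried over to the
    representatives, contributes to \<open>step_count b' a'\<close>.\<close>
  obtain \<gamma> \<delta> where gd: "\<gamma> \<in> \<Gamma>" "\<delta> \<in> \<Gamma>" "a' = act \<gamma> a" "b' = act \<delta> b"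
    using arc_rep_in_orbit[OF aT] arc_rep_in_orbit[OF bT] unfolding arc_orbit_def a'_def b'_def by blast
  let ?k = "\<delta> \<otimes>\<^bsub>A\<^esub> inv\<^bsub>A\<^esub> \<gamma>"
  have "act ?k a' = act \<delta> a"
    using gd act_mult[OF gd(2) inv_closed[OF gd(1)] DT[OF a'D]] act_inv(1)[OF gd(1) aT] by simp
  then have "(b', act ?k a') \<in> nb_step"
    using nb_step_act[OF gd(2) ba(1)] gd(4) by simp
  then have "?k \<in> {\<gamma> \<in> \<Gamma>. (b', act \<gamma> a') \<in> nb_step}" using gd by simp
  moreover have "finite {\<gamma> \<in> \<Gamma>. (b', act \<gamma> a') \<in> nb_step}"
  proof -
    have "{\<gamma> \<in> \<Gamma>. (b', act \<gamma> a') \<in> nb_step} = (\<Union>e\<in>nb_step `` {b'}. {\<gamma> \<in> \<Gamma>. act \<gamma> a' = e})"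
      by blast
    moreover have "finite (\<Union>e\<in>nb_step `` {b'}. {\<gamma> \<in> \<Gamma>. act \<gamma> a' = e})"
      by (intro finite_UN_I finite_succ finite_act_fibre DT a'D b'D)
    ultimately show ?thesis by (simp only:)
  qed
  ultimately have "step_count b' a' > 0" unfolding step_count_def card_gt_0_iff by blast
  then show False using N0 by simp
qed

text \<open>Walks of length \<open>n\<close> modulo the group, lifted so as to start at
  \<open>a\<close> itself; the group maps walks to walks, so it is enough to let it move the
  end.\<close>

definition reach :: "nat \<Rightarrow> 'v \<times> 'v \<Rightarrow> 'v \<times> 'v \<Rightarrow> bool" where
  "reach n a b \<longleftrightarrow> a \<in> parcs T \<and> b \<in> parcs T \<and> (\<exists>\<gamma>\<in>\<Gamma>. (a, act \<gamma> b) \<in> nb_step ^^ n)"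

lemma reach_arcs: "reach n a b \<Longrightarrow> a \<in> parcs T \<and> b \<in> parcs T"
  by (simp add: reach_def)

lemma reachI: "a \<in> parcs T \<Longrightarrow> b \<in> parcs T \<Longrightarrow> \<gamma> \<in> \<Gamma> \<Longrightarrow> (a, act \<gamma> b) \<in> nb_step ^^ n \<Longrightarrow> reach n a b"
  unfolding reach_def by blast

lemma reach_relpow:
  assumes "a \<in> parcs T" "(a, b) \<in> nb_step ^^ n"
  shows "reach n a b"
proof -
  have b: "b \<in> parcs T" using nb_relpow_arcs[OF assms(2)] assms(1) by simp
  show ?thesis
    by (rule reachI[OF assms(1) b one_closed]) (simp only: act_one[OF b] assms(2))
qed

lemma reach_step: "(a, b) \<in> nb_step \<Longrightarrow> reach 1 a b"
  by (rule reach_relpow) (simp_all add: nb_step_arcs)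

lemma reach_trans:
  assumes "reach m a b" "reach n b c"
  shows "reach (m + n) a c"
proof -
  obtain \<gamma> \<delta> where gd: "\<gamma> \<in> \<Gamma>" "(a, act \<gamma> b) \<in> nb_step ^^ m" "\<delta> \<in> \<Gamma>" "(b, act \<delta> c) \<in> nb_step ^^ n"
    using assms unfolding reach_def by blast
  have c: "c \<in> parcs T" and a: "a \<in> parcs T" using assms reach_arcs by blast+
  have "(act \<gamma> b, act \<gamma> (act \<delta> c)) \<in> nb_step ^^ n"
    by (rule aut_nb_relpow[OF in_aut[OF gd(1)] gd(4)])
  then have "(a, act (\<gamma> \<otimes>\<^bsub>A\<^esub> \<delta>) c) \<in> nb_step ^^ (m + n)"
    unfolding act_mult[OF gd(1) gd(3) c] by (rule relpow_trans[OF gd(2)])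
  then show ?thesis by (rule reachI[OF a c mult_closed[OF gd(1) gd(3)]])
qed

lemma reach_act_iff:
  assumes b: "b \<in> parcs T" and \<gamma>: "\<gamma> \<in> \<Gamma>"
  shows "reach n a (act \<gamma> b) \<longleftrightarrow> reach n a b"
proof
  assume r: "reach n a (act \<gamma> b)"
  then obtain \<delta> where \<delta>: "\<delta> \<in> \<Gamma>" "(a, act \<delta> (act \<gamma> b)) \<in> nb_step ^^ n"
    unfolding reach_def by blast
  then have "(a, act (\<delta> \<otimes>\<^bsub>A\<^esub> \<gamma>) b) \<in> nb_step ^^ n"
    by (simp only: act_mult[OF \<delta>(1) \<gamma> b])
  then show "reach n a b"
    using reach_arcs[OF r] by (intro reachI[OF _ b mult_closed[OF \<delta>(1) \<gamma>]]) simp_all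
next
  assume r: "reach n a b"
  then obtain \<delta> where \<delta>: "\<delta> \<in> \<Gamma>" "(a, act \<delta> b) \<in> nb_step ^^ n"
    unfolding reach_def by blast
  have "act (\<delta> \<otimes>\<^bsub>A\<^esub> inv\<^bsub>A\<^esub> \<gamma>) (act \<gamma> b) = act \<delta> b"
    by (simp only: act_mult[OF \<delta>(1) inv_closed[OF \<gamma>] act_arc[OF \<gamma> b]] act_inv(1)[OF \<gamma> b])
  then have "(a, act (\<delta> \<otimes>\<^bsub>A\<^esub> inv\<^bsub>A\<^esub> \<gamma>) (act \<gamma> b)) \<in> nb_step ^^ n"
    using \<delta>(2) by simp
  then show "reach n a (act \<gamma> b)"
    using reach_arcs[OF r]
    by (intro reachI[OF _ act_arc[OF \<gamma> b] mult_closed[OF \<delta>(1) inv_closed[OF \<gamma>]]]) simp_all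
qed

text \<open>What is reachable from \<open>b\<close> is closed under successors, hence under
  predecessors by \<open>predecessor_closed\<close>, and \<open>a\<close> is an iterated predecessor
  of a translate of \<open>b\<close>.\<close>

lemma reach_sym:
  assumes "reach n a b"
  shows "\<exists>m. reach m b a"
proof -
  define R where "R = {c. \<exists>m. reach m b c}"
  have RT: "R \<subseteq> parcs T" unfolding R_def using reach_arcs by blast
  have R_pred: "c \<in> R" if "(c, d) \<in> nb_step" "d \<in> R" for c d
  proof (rule predecessor_closed[OF RT _ _ that])
    show "act \<gamma> e \<in> R" if "\<gamma> \<in> \<Gamma>" "e \<in> R" for \<gamma> e
      using reach_act_iff[OF subsetD[OF RT that(2)] that(1)] that(2) unfolding R_def by blast
    show "f \<in> R" if "e \<in> R" "(e, f) \<in> nb_step" for e f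
      using reach_trans[OF _ reach_step[OF that(2)]] that(1) unfolding R_def by blast
  qed
  have R_relpow: "c \<in> R" if "(c, d) \<in> nb_step ^^ k" "d \<in> R" for c d k
    using that
  proof (induction k arbitrary: d)
    case (Suc k)
    then obtain e where "(c, e) \<in> nb_step ^^ k" "(e, d) \<in> nb_step" by (meson relpow_Suc_E)
    then show ?case using Suc.IH R_pred Suc.prems(2) by blast
  qed simp
  obtain \<gamma> where \<gamma>: "\<gamma> \<in> \<Gamma>" "(a, act \<gamma> b) \<in> nb_step ^^ n"
    using assms unfolding reach_def by blast
  have b: "b \<in> parcs T" using reach_arcs[OF assms] by simp
  have "reach 0 b b" by (rule reach_relpow[OF b]) simp
  then have "reach 0 b (act \<gamma> b)" using reach_act_iff[OF b \<gamma>(1)] by simp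
  then have "act \<gamma> b \<in> R" unfolding R_def by blast
  then have "a \<in> R" by (rule R_relpow[OF \<gamma>(2)])
  then show ?thesis unfolding R_def by blast
qed

lemma reach_loop: "reach n a a \<Longrightarrow> reach (k * n) a a"
proof (induction k)
  case 0
  then show ?case using reach_relpow[of a a 0] reach_arcs by simp
next
  case (Suc k)
  then show ?case using reach_trans[of n a a "k * n" a] by simp
qed

text \<open>
  If \<open>b\<close> and \<open>c\<close> are the arcs following \<open>a\<close> at a branching vertex, the walk may leave through \<open>c\<close>
  and come back through the reverse of \<open>b\<close>.
\<close>

lemma reach_reverse:
  assumes a: "a \<in> parcs T"
  shows "\<exists>X>0. \<forall>k>0. reach (k * X + 1) a (prod.swap a)"
proof -
  obtain u v where uv: "a = (u, v)" by (cases a)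
  obtain w w' where w: "w \<noteq> w'" "(a, (v, w)) \<in> nb_step" "(a, (v, w')) \<in> nb_step"
    using two_successors[of u v] a uv by blast
  have "((w, v), (v, w')) \<in> nb_step"
    using w nb_step_arcs[OF w(2)] nb_step_arcs[OF w(3)] by (simp add: nb_step_iff arc_commute)
  then have 1: "reach 1 (w, v) (v, w')" by (rule reach_step)
  obtain t where t: "reach t (v, w') (w, v)" using reach_sym[OF 1] by blast
  have 2: "reach 1 (w, v) (prod.swap a)"
    using reach_step[OF nb_step_swap[OF w(2)]] by simp
  have 3: "reach 1 a (v, w')" by (rule reach_step[OF w(3)])
  \<comment> \<open>The loop of length \<open>t + 1\<close> at \<open>(v, w')\<close> is run
    \<open>k - 1\<close> times; a last passage of the same length leaves it at \<open>(w, v)\<close>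
    for the reverse of \<open>a\<close>.\<close>
  have "reach (k * (t + 1) + 1) a (prod.swap a)" if kpos: "k > 0" for k
  proof -
    obtain j where j: "k = Suc j" using kpos by (cases k) auto
    have "reach (1 + (j * (t + 1) + (t + 1))) a (prod.swap a)"
      by (rule reach_trans[OF 3 reach_trans[OF reach_loop[OF reach_trans[OF t 1]] reach_trans[OF t 2]]])
    then show ?thesis by (simp add: j algebra_simps)
  qed
  then show ?thesis by (intro exI[of _ "t + 1"]) auto
qed

text \<open>Reversing twice, with different numbers of loops, gives closed walks of lengths
  \<open>2 * e\<close> and \<open>2 * (e + 1)\<close>; these combine to all large even
  lengths.\<close>

lemma reach_even_loops:
  assumes a: "a \<in> parcs T"
  shows "\<exists>M. \<forall>m\<ge>M. reach (2 * m) a a"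
proof -
  have a': "prod.swap a \<in> parcs T" using a arc_commute by (cases a) auto
  obtain X where X: "X > 0" "\<And>k. k > 0 \<Longrightarrow> reach (k * X + 1) a (prod.swap a)"
    using reach_reverse[OF a] by blast
  obtain Y where Y: "Y > 0" "\<And>k. k > 0 \<Longrightarrow> reach (k * Y + 1) (prod.swap a) a"
    using reach_reverse[OF a'] by auto
  \<comment> \<open>Two rounds of each loop have total length \<open>2 * e\<close>; one round of
    each has length \<open>e + 1\<close>, which is doubled since it may be odd.\<close>
  define e where "e = X + Y + 1"
  have "reach (2 * X + 1 + (2 * Y + 1)) a a"
    using reach_trans[OF X(2)[of 2] Y(2)[of 2]] by simp
  moreover have "2 * X + 1 + (2 * Y + 1) = 2 * e" by (simp add: e_def)
  ultimately have e1: "reach (2 * e) a a" by (simp only:)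
  have xy: "reach (X + 1 + (Y + 1)) a a"
    using reach_trans[OF X(2)[of 1] Y(2)[of 1]] by simp
  have "X + 1 + (Y + 1) + (X + 1 + (Y + 1)) = 2 * (e + 1)" by (simp add: e_def)
  then have e2: "reach (2 * (e + 1)) a a" using reach_trans[OF xy xy] by (simp only:)
  \<comment> \<open>Beyond \<open>e * e\<close> the quotient of \<open>m\<close> by \<open>e\<close>
    is at least the remainder, so \<open>?q - ?r\<close> short and \<open>?r\<close> long closed
    walks have total length \<open>2 * m\<close>.\<close>
  have "reach (2 * m) a a" if m: "m \<ge> e * e" for m
  proof -
    let ?q = "m div e" and ?r = "m mod e"
    have "e > 0" by (simp add: e_def)
    then have "?r < e" "e \<le> ?q" using m by (simp_all add: less_eq_div_iff_mult_less_eq)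
    then have rq: "?r \<le> ?q" by linarith
    have "reach ((?q - ?r) * (2 * e) + ?r * (2 * (e + 1))) a a"
      by (rule reach_trans[OF reach_loop[OF e1] reach_loop[OF e2]])
    moreover have "(?q - ?r) * (2 * e) + ?r * (2 * (e + 1)) = 2 * m"
    proof -
      obtain s where s: "?q = ?r + s" using rq le_Suc_ex by blast
      have "m = ?q * e + ?r" by simp
      also have "\<dots> = (?r + s) * e + ?r" by (simp only: s)
      finally have "m = (?r + s) * e + ?r" .
      moreover have "?q - ?r = s" using s by linarith
      ultimately show ?thesis by (simp add: algebra_simps)
    qed
    ultimately show ?thesis by (simp only:)
  qed
  then show ?thesis by blast
qed

text \<open>The tree connects any two arcs up to reversals at the two ends, and
  \<open>reach_reverse\<close> supplies these modulo the group.\<close>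

lemma reach_any:
  assumes a: "a \<in> parcs T" and b: "b \<in> parcs T"
  shows "\<exists>n. reach n a b"
proof -
  have adj: "\<exists>n. reach n (u, v) (v, w)" if uv: "(u, v) \<in> parcs T" and vw: "(v, w) \<in> parcs T" for u v w
  proof (cases "w = u")
    case True
    obtain X where X: "\<And>k. k > 0 \<Longrightarrow> reach (k * X + 1) (u, v) (v, u)"
      using reach_reverse[OF uv] by auto
    have "reach (1 * X + 1) (u, v) (v, u)" by (rule X) simp
    then show ?thesis using True by blast
  next
    case False
    then have "((u, v), (v, w)) \<in> nb_step" using uv vw by (simp add: nb_step_iff)
    then show ?thesis using reach_step by blast
  qed
  obtain u v where uv: "a = (u, v)" by (cases a)
  obtain y z where yz: "b = (y, z)" by (cases b)
  show ?thesis
  proof (cases "v = y")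
    case True
    then show ?thesis using adj a b uv yz by simp
  next
    case False
    have "v \<in> pverts T" "y \<in> pverts T" using a b uv yz in_arcsD1 in_arcsD2 by auto
    then obtain v' y' where v': "(v, v') \<in> parcs T" "((v, v'), (y', y)) \<in> nb_step\<^sup>*"
      using nb_walk_exists False by blast
    then obtain k where "((v, v'), (y', y)) \<in> nb_step ^^ k" by (auto simp: rtrancl_power)
    then have k: "reach k (v, v') (y', y)" by (rule reach_relpow[OF v'(1)])
    obtain n where n: "reach n a (v, v')" using adj[of u v v'] a uv v'(1) by auto
    obtain l where l: "reach l (y', y) b"
      using adj[of y' y z] b yz reach_arcs[OF k] by auto
    show ?thesis using reach_trans[OF n reach_trans[OF k l]] by blast
  qed
qed

lemma relpow_parity:
  "(a, b) \<in> nb_step ^^ n \<Longrightarrow> (fst a \<in> V0 \<longleftrightarrow> fst b \<in> V0) \<longleftrightarrow> even n"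
proof (induction n arbitrary: b)
  case (Suc n)
  then obtain c where c: "(a, c) \<in> nb_step ^^ n" "(c, b) \<in> nb_step" by (meson relpow_Suc_E)
  have "fst c \<in> V0 \<longleftrightarrow> fst b \<notin> V0"
    using c(2) arc_type by (cases c, cases b) (simp add: nb_step_iff)
  then show ?case using Suc.IH[OF c(1)] by auto
qed simp

lemma reach_parity:
  assumes "reach n a b"
  shows "(fst a \<in> V0 \<longleftrightarrow> fst b \<in> V0) \<longleftrightarrow> even n"
proof -
  obtain \<gamma> where \<gamma>: "\<gamma> \<in> \<Gamma>" "(a, act \<gamma> b) \<in> nb_step ^^ n"
    using assms unfolding reach_def by blast
  have "fst b \<in> pverts T" using arc_fst_in_verts reach_arcs[OF assms] by blast
  then show ?thesis using relpow_parity[OF \<gamma>(2)] aut_type[OF in_aut[OF \<gamma>(1)]] by simp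
qed

lemma eventually_reach:
  assumes a: "a \<in> parcs T" and b: "b \<in> parcs T"
  shows "\<exists>L0. \<forall>L\<ge>L0. ((fst a \<in> V0 \<longleftrightarrow> fst b \<in> V0) \<longleftrightarrow> even L) \<longrightarrow> reach L a b"
proof -
  obtain n where n: "reach n a b" using reach_any[OF a b] by blast
  obtain M where M: "\<And>m. m \<ge> M \<Longrightarrow> reach (2 * m) a a" using reach_even_loops[OF a] by blast
  have "reach L a b"
    if L: "L \<ge> 2 * M + n" "(fst a \<in> V0 \<longleftrightarrow> fst b \<in> V0) \<longleftrightarrow> even L" for L
  proof -
    have "even L \<longleftrightarrow> even n" using L(2) reach_parity[OF n] by blast
    then have "even (L - n)" using L(1) by simp
    then obtain m where m: "L - n = 2 * m" by (rule evenE)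
    have "m \<ge> M" using m L(1) by linarith
    then have "reach (2 * m + n) a b" by (rule reach_trans[OF M n])
    moreover have "2 * m + n = L" using m L(1) by linarith
    ultimately show ?thesis by (simp only:)
  qed
  then show ?thesis by blast
qed

lemma ray_parity:
  assumes "nonbacktracking r"
  shows "(r m \<in> V0 \<longleftrightarrow> r (m + k) \<in> V0) \<longleftrightarrow> even k"
  using relpow_parity[OF nonbacktracking_relpow[OF assms, of m k]] by simp

text \<open>
  The ray \<open>q\<close> follows \<open>t\<close> up to the index \<open>N\<close> and a translate of \<open>s\<close> from the index \<open>N + L0\<close> on,
  with the same parametrization; in between it is a walk of the prescribed length \<open>L0\<close>.
\<close>

lemma ray_gluing:
  assumes s: "nonbacktracking s" and t: "nonbacktracking t" and type: "s 0 \<in> V0 \<longleftrightarrow> t 0 \<in> V0"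
  shows "\<exists>\<gamma>\<in>\<Gamma>. \<exists>q M. nonbacktracking q \<and> (\<forall>i\<le>N. q i = t i) \<and> (\<forall>i\<ge>M. q i = \<gamma> (s i))"
proof -
  have arc: "(t i, t (Suc i)) \<in> parcs T" "(s i, s (Suc i)) \<in> parcs T" for i
    using s t by (auto simp: nonbacktracking_def)
  obtain D where D: "finite D" "D \<subseteq> parcs T" "\<And>a. a \<in> parcs T \<Longrightarrow> \<exists>\<gamma>\<in>\<Gamma>. act \<gamma> a \<in> D"
    using finite_quotient by blast
  let ?b = "(t N, t (Suc N))"
  have "\<forall>d\<in>D. \<exists>L0. \<forall>L\<ge>L0. ((fst ?b \<in> V0 \<longleftrightarrow> fst d \<in> V0) \<longleftrightarrow> even L) \<longrightarrow> reach L ?b d"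
    using eventually_reach[OF arc(1)] D(2) by blast
  then obtain l where l: "\<forall>d\<in>D. \<forall>L\<ge>l d. ((fst ?b \<in> V0 \<longleftrightarrow> fst d \<in> V0) \<longleftrightarrow> even L) \<longrightarrow> reach L ?b d"
    by (rule bchoice[THEN exE])
  \<comment> \<open>The arc of \<open>s\<close> to be reached depends on the length of the walk. A
    threshold common to the finitely many representatives in \<open>D\<close> fixes the length
    before the arc is known.\<close>
  define L0 where "L0 = Max (insert 0 (l ` D))"
  have L0: "L0 \<ge> l d" if "d \<in> D" for d using D(1) that by (simp add: L0_def)
  define m where "m = N + L0"
  let ?a = "(s m, s (Suc m))"
  obtain \<gamma> where \<gamma>: "\<gamma> \<in> \<Gamma>" "act \<gamma> ?a \<in> D" using D(3)[OF arc(2)] by blast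
  have sV: "s m \<in> pverts T" by (rule nonbacktracking_verts[OF s])
  have "s m \<in> V0 \<longleftrightarrow> t m \<in> V0"
    using ray_parity[OF s, of 0 m] ray_parity[OF t, of 0 m] type by auto
  then have "(fst ?b \<in> V0 \<longleftrightarrow> fst (act \<gamma> ?a) \<in> V0) \<longleftrightarrow> even L0"
    using ray_parity[OF t, of N L0] aut_type[OF in_aut[OF \<gamma>(1)] sV] by (simp add: m_def)
  then have "reach L0 ?b (act \<gamma> ?a)"
    using l[rule_format, OF \<gamma>(2) L0[OF \<gamma>(2)]] by blast
  then have "reach L0 ?b ?a" using reach_act_iff[OF arc(2) \<gamma>(1)] by simp
  then obtain \<delta> where \<delta>: "\<delta> \<in> \<Gamma>" "(?b, act \<delta> ?a) \<in> nb_step ^^ L0"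
    unfolding reach_def by blast
  obtain p where p: "nonbacktracking p" "?b = (p 0, p 1)" "act \<delta> ?a = (p L0, p (Suc L0))"
    using nb_walk_extend[OF \<delta>(2) act_arc[OF \<delta>(1) arc(2)]] by blast
  define q1 where "q1 i = (if i \<le> N then t i else p (i - N + 0))" for i
  have q1: "nonbacktracking q1"
    unfolding q1_def using p(2) by (intro nonbacktracking_glue t p(1)) auto
  \<comment> \<open>The index \<open>i - m + m\<close> is \<open>i\<close> beyond \<open>m\<close>,
    written to match \<open>nonbacktracking_glue\<close>: the parametrization of \<open>s\<close> is
    kept.\<close>
  define q where "q i = (if i \<le> m then q1 i else \<delta> (s (i - m + m)))" for i
  have "q1 m = p L0" "q1 (Suc m) = p (Suc L0)"
    using p(2) by (auto simp: q1_def m_def Suc_diff_le)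
  then have "q1 m = \<delta> (s m)" "q1 (Suc m) = \<delta> (s (Suc m))"
    using p(3) by simp_all
  then have "nonbacktracking q"
    unfolding q_def
    using nonbacktracking_glue[OF q1 aut_nonbacktracking[OF in_aut[OF \<delta>(1)] s], of m m] by simp
  moreover have "\<forall>i\<le>N. q i = t i" by (simp add: q_def q1_def m_def)
  moreover have "\<forall>i\<ge>Suc m. q i = \<delta> (s i)" by (simp add: q_def)
  ultimately show ?thesis using \<delta>(1) by blast
qed

end

section \<open>Density of horospherical orbits\<close>

context tree_group
begin

text \<open>An element is determined by its restriction to \<open>F\<close>, and
  \<open>finite_fibre_image\<close> leaves finitely many restrictions.\<close>

lemma finite_fibre_if_discrete:
  assumes F: "finite F" "F \<subseteq> pverts T" "\<And>g. g \<in> G \<Longrightarrow> \<forall>v\<in>F. g v = v \<Longrightarrow> g = \<one>\<^bsub>A\<^esub>"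
    and x: "x \<in> pverts T"
  shows "finite {g \<in> G. g x = y}"
proof -
  let ?S = "{g \<in> G. g x = y}"
  let ?B = "\<lambda>v. {g v | g. g \<in> G \<and> g x = y}"
  have "(\<lambda>g. restrict g F) ` ?S \<subseteq> Pi\<^sub>E F ?B"
    by (rule image_subsetI) (simp add: PiE_iff, blast)
  moreover have "finite (Pi\<^sub>E F ?B)"
    by (intro finite_PiE F(1) finite_fibre_image[OF x]) (use F(2) in blast)
  ultimately have "finite ((\<lambda>g. restrict g F) ` ?S)" by (rule finite_subset)
  moreover have "inj_on (\<lambda>g. restrict g F) ?S"
  proof (rule inj_onI)
    fix g h assume "g \<in> ?S" "h \<in> ?S" and eq: "restrict g F = restrict h F"
    then have g: "g \<in> G" and h: "h \<in> G" by auto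
    have "(inv\<^bsub>A\<^esub> g \<otimes>\<^bsub>A\<^esub> h) v = v" if v: "v \<in> F" for v
    proof -
      have "h v = g v" using eq v by (metis restrict_apply')
      then show ?thesis using v F(2) g h aut_inv(1)[of g v] by (auto simp: aut_mult)
    qed
    then have "inv\<^bsub>A\<^esub> g \<otimes>\<^bsub>A\<^esub> h = \<one>\<^bsub>A\<^esub>"
      using g h by (intro F(3)) simp_all
    then show "g = h"
      using g h by (metis aut.inv_equality aut.inv_inv aut.inv_closed in_aut)
  qed
  ultimately show ?thesis by (rule finite_imageD)
qed

text \<open>Fixing a tail of \<open>r\<close> preserves cofinality with \<open>r\<close>; the
  inverse of \<open>u\<close> fixes the same tail and gives the other inclusion. The vertex
  \<open>r M\<close> shows that \<open>u\<close> is elliptic.\<close>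

lemma horospherical_stabilizerI:
  assumes u: "u \<in> G" and r: "nonbacktracking r" and fix_ray: "\<And>i. i \<ge> M \<Longrightarrow> u (r i) = r i"
  shows "u \<in> horospherical_stabilizer T G (ray_rel T `` {r})"
proof -
  have sub: "(\<lambda>i. w (p i)) \<in> ray_rel T `` {r}"
    if w: "w \<in> G" "\<And>i. i \<ge> M \<Longrightarrow> w (r i) = r i" and p: "p \<in> ray_rel T `` {r}" for w p
  proof -
    obtain m n where mn: "\<And>k. r (m + k) = p (n + k)" and p_ray: "nonbacktracking p"
      using p by (auto simp: ray_rel_def rays_eq)
    have "r ((m + M) + k) = w (p ((n + M) + k))" for k
      using mn[of "M + k"] w(2)[of "m + (M + k)"] by (simp add: add.assoc)
    then have "\<exists>m n. \<forall>k. r (m + k) = w (p (n + k))" by blast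
    then show ?thesis
      using r aut_nonbacktracking[OF in_aut[OF w(1)] p_ray] by (simp add: ray_rel_def rays_eq)
  qed
  have inv_fix: "(inv\<^bsub>A\<^esub> u) (r i) = r i" if "i \<ge> M" for i
    using aut_inv(1)[OF in_aut[OF u] nonbacktracking_verts[OF r, of i]] fix_ray[OF that] by simp
  have "boundary_action u (ray_rel T `` {r}) = ray_rel T `` {r}"
  proof
    show "boundary_action u (ray_rel T `` {r}) \<subseteq> ray_rel T `` {r}"
      unfolding boundary_action_def comp_def by (rule image_subsetI) (rule sub[OF u fix_ray])
    show "ray_rel T `` {r} \<subseteq> boundary_action u (ray_rel T `` {r})"
    proof
      fix p assume p: "p \<in> ray_rel T `` {r}"
      have pV: "p i \<in> pverts T" for i
        using p nonbacktracking_verts by (auto simp: ray_rel_def rays_eq)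
      have "p = u \<circ> (\<lambda>i. (inv\<^bsub>A\<^esub> u) (p i))"
        using aut_inv(2)[OF in_aut[OF u] pV] by (simp add: comp_def)
      moreover have "(\<lambda>i. (inv\<^bsub>A\<^esub> u) (p i)) \<in> ray_rel T `` {r}"
        by (rule sub[OF inv_closed[OF u] inv_fix p])
      ultimately show "p \<in> boundary_action u (ray_rel T `` {r})"
        unfolding boundary_action_def by (rule image_eqI)
    qed
  qed
  moreover have "elliptic T u"
    unfolding elliptic_def using fix_ray[of M] nonbacktracking_verts[OF r, of M] by blast
  ultimately show ?thesis using u by (simp add: horospherical_stabilizer_def)
qed

end

section \<open>Combinatorial consequences of being a uniform lattice\<close>

locale uniform_lattice_group = closed_tree_group T V0 V1 d0 d1 G
  for T :: "'v pair_pre_digraph" and V0 V1 :: "'v set" and d0 d1 :: nat and G :: "('v \<Rightarrow> 'v) set" +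
  fixes \<Gamma> :: "('v \<Rightarrow> 'v) set"
  assumes noncompact: "\<not> compactin (aut_topology T V0 V1) G"
    and trans: "transitive_on_boundary T G"
    and lattice: "uniform_lattice (subtopology (aut_topology T V0 V1) G) (A\<lparr>carrier := G\<rparr>) \<Gamma>"
begin

abbreviation "GG \<equiv> A\<lparr>carrier := G\<rparr>"
abbreviation "\<tau> \<equiv> subtopology (aut_topology T V0 V1) G"

lemma lattice_subgroup_GG: "subgroup \<Gamma> GG"
  using lattice by (simp add: uniform_lattice_def)

lemma lattice_subset: "\<Gamma> \<subseteq> G"
  using subgroup.subset[OF lattice_subgroup_GG] by simp

lemma lattice_subgroup: "subgroup \<Gamma> A"
  by (rule aut.incl_subgroup[OF subgroup lattice_subgroup_GG])

lemma tree_group_lattice: "tree_group T V0 V1 d0 d1 \<Gamma>"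
  by (intro tree_group.intro tree_group_axioms.intro thick_tree_axioms lattice_subgroup)

lemma topspace_tau: "topspace \<tau> = G"
  using in_aut by auto

lemma lcoset_eq: "g <#\<^bsub>GG\<^esub> \<Gamma> = g <#\<^bsub>A\<^esub> \<Gamma>"
  by (simp add: l_coset_def)

lemma lcoset_mult:
  assumes "g \<in> G" "\<gamma> \<in> \<Gamma>"
  shows "(g \<otimes>\<^bsub>A\<^esub> \<gamma>) <#\<^bsub>A\<^esub> \<Gamma> = g <#\<^bsub>A\<^esub> \<Gamma>"
proof -
  have "g \<otimes>\<^bsub>A\<^esub> \<gamma> \<in> g <#\<^bsub>A\<^esub> \<Gamma>" using assms(2) by (auto simp: l_coset_def)
  then show ?thesis
    using aut.l_repr_independence[OF _ in_aut[OF assms(1)] lattice_subgroup] by simp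
qed

lemma openin_coset_space:
  "openin (coset_space \<tau> GG \<Gamma>) W \<longleftrightarrow>
    W \<subseteq> (\<lambda>g. g <#\<^bsub>A\<^esub> \<Gamma>) ` G \<and> openin \<tau> {g \<in> G. g <#\<^bsub>A\<^esub> \<Gamma> \<in> W}"
  unfolding coset_space_def openin_quotient_topology topspace_tau lcoset_eq ..

lemma topspace_cosets: "topspace (coset_space \<tau> GG \<Gamma>) = (\<lambda>g. g <#\<^bsub>A\<^esub> \<Gamma>) ` G"
  unfolding coset_space_def topspace_quotient_topology topspace_tau lcoset_eq ..

text \<open>The identity is isolated in \<Gamma>, so some finite set of vertices has trivial
  pointwise stabilizer there.\<close>

lemma lattice_finite_fibre:
  assumes "x \<in> pverts T"
  shows "finite {\<gamma> \<in> \<Gamma>. \<gamma> x = y}"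
proof -
  interpret \<Gamma>: tree_group T V0 V1 d0 d1 \<Gamma> by (rule tree_group_lattice)
  have "G \<inter> \<Gamma> = \<Gamma>" using lattice_subset by blast
  then have "subtopology (aut_topology T V0 V1) \<Gamma> = discrete_topology \<Gamma>"
    using lattice by (simp add: uniform_lattice_def subtopology_subtopology)
  then have "openin (subtopology (aut_topology T V0 V1) \<Gamma>) {\<one>\<^bsub>A\<^esub>}"
    using \<Gamma>.one_closed by simp
  then have "\<exists>F. finite F \<and> F \<subseteq> pverts T \<and>
      (\<forall>g\<in>\<Gamma>. (\<forall>v\<in>F. g v = \<one>\<^bsub>A\<^esub> v) \<longrightarrow> g \<in> {\<one>\<^bsub>A\<^esub>})"
    unfolding \<Gamma>.openin_group by simp
  then obtain F where F: "finite F" "F \<subseteq> pverts T"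
      "\<forall>g\<in>\<Gamma>. (\<forall>v\<in>F. g v = \<one>\<^bsub>A\<^esub> v) \<longrightarrow> g \<in> {\<one>\<^bsub>A\<^esub>}"
    by (elim exE conjE)
  show ?thesis
  proof (rule \<Gamma>.finite_fibre_if_discrete[OF F(1,2) _ assms])
    fix g assume g: "g \<in> \<Gamma>" "\<forall>v\<in>F. g v = v"
    then have "\<forall>v\<in>F. g v = \<one>\<^bsub>A\<^esub> v" using F(2) aut_one by auto
    then show "g = \<one>\<^bsub>A\<^esub>" using F(3) g(1) by simp
  qed
qed

text \<open>The cosets of elements taking \<open>y\<close> to \<open>x\<close> form an open set
  \<open>W y\<close>. These sets cover the compact coset space, and the \<open>y\<close> of a finite
  subcover form \<open>Y\<close>.\<close>

lemma lattice_vertex_orbits: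
  assumes x: "x \<in> pverts T"
  shows "\<exists>Y. finite Y \<and> (\<forall>g\<in>G. \<exists>\<gamma>\<in>\<Gamma>. \<gamma> (g x) \<in> Y)"
proof -
  interpret \<Gamma>: tree_group T V0 V1 d0 d1 \<Gamma> by (rule tree_group_lattice)
  let ?X = "coset_space \<tau> GG \<Gamma>"
  define W where "W y = (\<lambda>g. g <#\<^bsub>A\<^esub> \<Gamma>) ` {g \<in> G. g y = x}" for y
  have W_iff: "g <#\<^bsub>A\<^esub> \<Gamma> \<in> W y \<longleftrightarrow> (\<exists>\<gamma>\<in>\<Gamma>. g (\<gamma> y) = x)" if g: "g \<in> G" and y: "y \<in> pverts T" for g y
  proof
    assume "g <#\<^bsub>A\<^esub> \<Gamma> \<in> W y"
    then obtain h where h: "h \<in> G" "h y = x" "g <#\<^bsub>A\<^esub> \<Gamma> = h <#\<^bsub>A\<^esub> \<Gamma>"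
      unfolding W_def by blast
    have "h \<in> h <#\<^bsub>A\<^esub> \<Gamma>"
      by (rule aut.lcos_self[OF in_aut[OF h(1)] lattice_subgroup])
    then have "h \<in> g <#\<^bsub>A\<^esub> \<Gamma>" by (simp only: h(3))
    then obtain \<gamma> where \<gamma>: "\<gamma> \<in> \<Gamma>" "h = g \<otimes>\<^bsub>A\<^esub> \<gamma>" unfolding l_coset_def by blast
    then have "g (\<gamma> y) = x" using h(2) aut_mult[OF in_aut[OF g] \<Gamma>.in_aut[OF \<gamma>(1)] y] by simp
    then show "\<exists>\<gamma>\<in>\<Gamma>. g (\<gamma> y) = x" using \<gamma>(1) by blast
  next
    assume "\<exists>\<gamma>\<in>\<Gamma>. g (\<gamma> y) = x"
    then obtain \<gamma> where \<gamma>: "\<gamma> \<in> \<Gamma>" "g (\<gamma> y) = x" by blast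
    have "g \<otimes>\<^bsub>A\<^esub> \<gamma> \<in> {g \<in> G. g y = x}"
      using \<gamma> g lattice_subset aut_mult[OF in_aut[OF g] \<Gamma>.in_aut[OF \<gamma>(1)] y] by auto
    then show "g <#\<^bsub>A\<^esub> \<Gamma> \<in> W y"
      unfolding W_def by (rule image_eqI[rotated]) (rule lcoset_mult[OF g \<gamma>(1), symmetric])
  qed
  have "openin ?X (W y)" if y: "y \<in> pverts T" for y
    unfolding openin_coset_space
  proof
    show "W y \<subseteq> (\<lambda>g. g <#\<^bsub>A\<^esub> \<Gamma>) ` G" unfolding W_def by blast
    show "openin \<tau> {g \<in> G. g <#\<^bsub>A\<^esub> \<Gamma> \<in> W y}"
      unfolding openin_group
    proof (intro conjI ballI)
      fix f assume "f \<in> {g \<in> G. g <#\<^bsub>A\<^esub> \<Gamma> \<in> W y}"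
      then obtain \<gamma> where \<gamma>: "\<gamma> \<in> \<Gamma>" "f (\<gamma> y) = x" using W_iff[OF _ y] by auto
      have "g \<in> {g \<in> G. g <#\<^bsub>A\<^esub> \<Gamma> \<in> W y}" if "g \<in> G" "\<forall>v\<in>{\<gamma> y}. g v = f v" for g
        using that \<gamma> W_iff[OF that(1) y] by auto
      then show "\<exists>F. finite F \<and> F \<subseteq> pverts T \<and>
          (\<forall>g\<in>G. (\<forall>v\<in>F. g v = f v) \<longrightarrow> g \<in> {g \<in> G. g <#\<^bsub>A\<^esub> \<Gamma> \<in> W y})"
        using aut_verts[OF \<Gamma>.in_aut[OF \<gamma>(1)] y] by (intro exI[of _ "{\<gamma> y}"]) auto
    qed auto
  qed
  then have op: "\<forall>U\<in>W ` pverts T. openin ?X U" by blast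
  have cov: "topspace ?X \<subseteq> \<Union> (W ` pverts T)"
  proof
    fix z assume "z \<in> topspace ?X"
    then obtain g where g: "g \<in> G" "z = g <#\<^bsub>A\<^esub> \<Gamma>" unfolding topspace_cosets by blast
    have "g ((inv\<^bsub>A\<^esub> g) x) = x" by (rule aut_inv(2)[OF in_aut[OF g(1)] x])
    then have "z \<in> W ((inv\<^bsub>A\<^esub> g) x)" unfolding W_def g(2) using g(1) by blast
    moreover have "(inv\<^bsub>A\<^esub> g) x \<in> pverts T"
      by (rule aut_verts[OF in_aut[OF inv_closed[OF g(1)]] x])
    ultimately show "z \<in> \<Union> (W ` pverts T)" by blast
  qed
  have "compactin ?X (topspace ?X)"
    using lattice by (simp add: uniform_lattice_def compact_space_def)
  then have "\<exists>\<F>. finite \<F> \<and> \<F> \<subseteq> W ` pverts T \<and> topspace ?X \<subseteq> \<Union> \<F>"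
    using op cov unfolding compactin_def by blast
  then obtain \<F> where \<F>: "finite \<F>" "\<F> \<subseteq> W ` pverts T" "topspace ?X \<subseteq> \<Union> \<F>"
    by (elim exE conjE)
  obtain Y where Y: "finite Y" "Y \<subseteq> pverts T" "\<F> = W ` Y"
    using finite_subset_image[OF \<F>(1,2)] by blast
  have "\<exists>\<gamma>\<in>\<Gamma>. \<gamma> (g x) \<in> Y" if g: "g \<in> G" for g
  proof -
    \<comment> \<open>Elements of a left coset have inverses that agree up to \<Gamma> on the left,
      so the cover is applied to the inverse of \<open>g\<close>.\<close>
    let ?h = "inv\<^bsub>A\<^esub> g"
    have h: "?h \<in> G" using g by simp
    then have "?h <#\<^bsub>A\<^esub> \<Gamma> \<in> topspace ?X" unfolding topspace_cosets by blast
    then obtain y where y: "y \<in> Y" "?h <#\<^bsub>A\<^esub> \<Gamma> \<in> W y" using \<F>(3) Y(3) by blast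
    have yV: "y \<in> pverts T" using y(1) Y(2) by blast
    then obtain \<gamma> where \<gamma>: "\<gamma> \<in> \<Gamma>" "?h (\<gamma> y) = x" using W_iff[OF h yV] y(2) by blast
    have "g x = \<gamma> y"
      using aut_inv(2)[OF in_aut[OF g] aut_verts[OF \<Gamma>.in_aut[OF \<gamma>(1)] yV]] \<gamma>(2) by simp
    then have "(inv\<^bsub>A\<^esub> \<gamma>) (g x) = y"
      using aut_inv(1)[OF \<Gamma>.in_aut[OF \<gamma>(1)] yV] by simp
    then show ?thesis using y(1) \<Gamma>.inv_closed[OF \<gamma>(1)] by blast
  qed
  then show ?thesis using Y(1) by blast
qed

text \<open>Finitely many \<open>G\<close>-orbits of vertices, each split into finitely many
  \<Gamma>-orbits, and finitely many arcs leaving each vertex.\<close>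

lemma uniform_tree_group_lattice: "uniform_tree_group T V0 V1 d0 d1 \<Gamma>"
proof -
  interpret \<Gamma>: tree_group T V0 V1 d0 d1 \<Gamma> by (rule tree_group_lattice)
  obtain D where D: "finite D" "D \<subseteq> pverts T" "\<forall>v\<in>pverts T. \<exists>g\<in>G. g v \<in> D"
    using finitely_many_vertex_orbits[OF trans noncompact] by (elim exE conjE)
  have "\<forall>d\<in>D. \<exists>Y. finite Y \<and> (\<forall>g\<in>G. \<exists>\<gamma>\<in>\<Gamma>. \<gamma> (g d) \<in> Y)"
    using lattice_vertex_orbits D(2) by blast
  then obtain Y where Y: "\<forall>d\<in>D. finite (Y d) \<and> (\<forall>g\<in>G. \<exists>\<gamma>\<in>\<Gamma>. \<gamma> (g d) \<in> Y d)"
    by (rule bchoice[THEN exE])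
  define E where "E = (\<Union>u\<in>\<Union> (Y ` D). Pair u ` nbrs u)"
  have "finite E" unfolding E_def using D(1) Y finite_nbrs by simp
  moreover have "E \<subseteq> parcs T" unfolding E_def nbrs_def by blast
  moreover have "\<exists>\<gamma>\<in>\<Gamma>. map_prod \<gamma> \<gamma> a \<in> E" if a: "a \<in> parcs T" for a
  proof -
    obtain u w where uw: "a = (u, w)" by (cases a)
    have uV: "u \<in> pverts T" using a uw in_arcsD1 by simp
    then obtain g where g: "g \<in> G" "g u \<in> D" using D(3) by blast
    obtain \<gamma> where \<gamma>: "\<gamma> \<in> \<Gamma>" "\<gamma> ((inv\<^bsub>A\<^esub> g) (g u)) \<in> Y (g u)"
      using Y g inv_closed[OF g(1)] by blast
    then have "\<gamma> u \<in> \<Union> (Y ` D)" using aut_inv(1)[OF in_aut[OF g(1)] uV] g(2) by auto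
    moreover have "map_prod \<gamma> \<gamma> a \<in> parcs T" by (rule aut_map_arc[OF \<Gamma>.in_aut[OF \<gamma>(1)] a])
    then have "\<gamma> w \<in> nbrs (\<gamma> u)" by (simp add: uw nbrs_def)
    ultimately have "map_prod \<gamma> \<gamma> a \<in> E" unfolding E_def uw by auto
    then show ?thesis using \<gamma>(1) by blast
  qed
  ultimately show ?thesis
    by unfold_locales (use lattice_finite_fibre in blast)+
qed

text \<open>Density tested on basic neighbourhoods: multiplying by \<open>\<gamma>\<close> on the
  right does not change the coset of \<open>u g0\<close>.\<close>

lemma horospherical_orbit_dense:
  assumes r: "nonbacktracking r" and g0: "g0 \<in> G" and g: "g \<in> G" and F: "finite F" "F \<subseteq> pverts T"
  shows "\<exists>u\<in>horospherical_stabilizer T G (ray_rel T `` {r}). \<exists>\<gamma>\<in>\<Gamma>.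
    \<forall>v\<in>F. (u \<otimes>\<^bsub>A\<^esub> g0 \<otimes>\<^bsub>A\<^esub> \<gamma>) v = g v"
proof -
  interpret \<Gamma>: uniform_tree_group T V0 V1 d0 d1 \<Gamma> by (rule uniform_tree_group_lattice)
  define s where "s i = (inv\<^bsub>A\<^esub> g0) (r i)" for i
  define t where "t i = (inv\<^bsub>A\<^esub> g) (r i)" for i
  have rV: "r i \<in> pverts T" for i by (rule nonbacktracking_verts[OF r])
  have s: "nonbacktracking s" and t: "nonbacktracking t"
    unfolding s_def t_def
    by (rule aut_nonbacktracking[OF in_aut[OF inv_closed[OF g0]] r],
        rule aut_nonbacktracking[OF in_aut[OF inv_closed[OF g]] r])
  have type: "s 0 \<in> V0 \<longleftrightarrow> t 0 \<in> V0"
    using g0 g rV by (simp add: s_def t_def aut_type)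
  have tV: "t i \<in> pverts T" and sV: "s i \<in> pverts T" for i
    using s t nonbacktracking_verts by blast+
  \<comment> \<open>\<open>r 0\<close> is added because \<open>open_ray_orbit\<close> asks for a
    nonempty set.\<close>
  let ?F = "insert (r 0) F"
  have F': "finite ?F" "?F \<subseteq> pverts T" "?F \<noteq> {}" using F rV by auto
  obtain N where N: "\<And>q. nonbacktracking q \<Longrightarrow> \<forall>i\<le>N. q i = t i \<Longrightarrow>
      \<exists>k\<in>G. (\<forall>v\<in>?F. k v = v) \<and> (\<forall>i\<ge>N. q i = k (t i))"
    using open_ray_orbit[OF trans F' t] by blast
  obtain \<gamma> q M where \<gamma>: "\<gamma> \<in> \<Gamma>" and q: "nonbacktracking q" "\<forall>i\<le>N. q i = t i" "\<forall>i\<ge>M. q i = \<gamma> (s i)"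
    using \<Gamma>.ray_gluing[OF s t type, of N] by blast
  obtain k where k: "k \<in> G" "\<forall>v\<in>?F. k v = v" "\<forall>i\<ge>N. q i = k (t i)"
    using N[OF q(1,2)] by blast
  have \<gamma>G: "\<gamma> \<in> G" using \<gamma> lattice_subset by blast
  define u where "u = g \<otimes>\<^bsub>A\<^esub> inv\<^bsub>A\<^esub> k \<otimes>\<^bsub>A\<^esub> \<gamma> \<otimes>\<^bsub>A\<^esub> inv\<^bsub>A\<^esub> g0"
  have u: "u \<in> G" unfolding u_def using g k(1) \<gamma>G g0 by simp
  have "u (r i) = r i" if i: "i \<ge> max M N" for i
  proof -
    have "u (r i) = g ((inv\<^bsub>A\<^esub> k) (\<gamma> (s i)))"
      unfolding u_def s_def using g k(1) \<gamma>G g0 rV by (simp add: aut_mult aut_verts)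
    also have "\<gamma> (s i) = k (t i)" using q(3) k(3) i by (metis max.bounded_iff)
    also have "(inv\<^bsub>A\<^esub> k) (k (t i)) = t i" by (rule aut_inv(1)[OF in_aut[OF k(1)] tV])
    also have "g (t i) = r i" unfolding t_def by (rule aut_inv(2)[OF in_aut[OF g] rV])
    finally show ?thesis .
  qed
  then have "u \<in> horospherical_stabilizer T G (ray_rel T `` {r})"
    by (rule horospherical_stabilizerI[OF u r])
  moreover have "inv\<^bsub>A\<^esub> \<gamma> \<in> \<Gamma>" using \<gamma> by simp
  moreover have "(u \<otimes>\<^bsub>A\<^esub> g0 \<otimes>\<^bsub>A\<^esub> inv\<^bsub>A\<^esub> \<gamma>) v = g v" if v: "v \<in> F" for v
  proof -
    have vV: "v \<in> pverts T" using v F(2) by blast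
    have "u \<otimes>\<^bsub>A\<^esub> g0 \<otimes>\<^bsub>A\<^esub> inv\<^bsub>A\<^esub> \<gamma> = g \<otimes>\<^bsub>A\<^esub> inv\<^bsub>A\<^esub> k"
      unfolding u_def using g k(1) \<gamma>G g0 by (simp add: aut.m_assoc aut.inv_solve_right')
    moreover have "(inv\<^bsub>A\<^esub> k) v = v"
      using aut_inv(1)[OF in_aut[OF k(1)] vV] k(2) v by simp
    ultimately show ?thesis using g k(1) vV by (simp add: aut_mult)
  qed
  ultimately show ?thesis by blast
qed

lemma minimal_horospherical_action:
  assumes \<xi>: "\<xi> \<in> tree_boundary T"
  shows "minimal_action (A\<lparr>carrier := horospherical_stabilizer T G \<xi>\<rparr>)
    (\<lambda>g x. g <#\<^bsub>A\<^esub> x) (coset_space \<tau> GG \<Gamma>)"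
proof -
  obtain r where r: "nonbacktracking r" "\<xi> = ray_rel T `` {r}"
    using \<xi> by (auto simp: tree_boundary_def rays_eq elim!: quotientE)
  let ?X = "coset_space \<tau> GG \<Gamma>"
  let ?H = "A\<lparr>carrier := horospherical_stabilizer T G \<xi>\<rparr>"
  have "y \<in> ?X closure_of (orbit ?H (\<lambda>g x. g <#\<^bsub>A\<^esub> x) x)"
    if x: "x \<in> topspace ?X" and y: "y \<in> topspace ?X" for x y
    unfolding in_closure_of
  proof (intro conjI allI impI y)
    fix W assume W: "y \<in> W \<and> openin ?X W"
    obtain g0 where g0: "g0 \<in> G" "x = g0 <#\<^bsub>A\<^esub> \<Gamma>" using x unfolding topspace_cosets by blast
    obtain g where g: "g \<in> G" "y = g <#\<^bsub>A\<^esub> \<Gamma>" using y unfolding topspace_cosets by blast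
    have "openin \<tau> {g \<in> G. g <#\<^bsub>A\<^esub> \<Gamma> \<in> W}" using W unfolding openin_coset_space by blast
    moreover have "g \<in> {g \<in> G. g <#\<^bsub>A\<^esub> \<Gamma> \<in> W}" using W g by blast
    ultimately have "\<exists>F. finite F \<and> F \<subseteq> pverts T \<and>
        (\<forall>h\<in>G. (\<forall>v\<in>F. h v = g v) \<longrightarrow> h \<in> {g \<in> G. g <#\<^bsub>A\<^esub> \<Gamma> \<in> W})"
      unfolding openin_group by (elim conjE) (erule (1) bspec)
    then obtain F where F: "finite F" "F \<subseteq> pverts T"
        "\<forall>h\<in>G. (\<forall>v\<in>F. h v = g v) \<longrightarrow> h \<in> {g \<in> G. g <#\<^bsub>A\<^esub> \<Gamma> \<in> W}"
      by (elim exE conjE)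
    obtain u \<gamma> where u: "u \<in> horospherical_stabilizer T G \<xi>" and \<gamma>: "\<gamma> \<in> \<Gamma>"
      and eq: "\<forall>v\<in>F. (u \<otimes>\<^bsub>A\<^esub> g0 \<otimes>\<^bsub>A\<^esub> \<gamma>) v = g v"
      using horospherical_orbit_dense[OF r(1) g0(1) g(1) F(1,2)] unfolding r(2) by blast
    have uG: "u \<in> G" using u by (simp add: horospherical_stabilizer_def)
    have ug: "u \<otimes>\<^bsub>A\<^esub> g0 \<in> G" by (rule mult_closed[OF uG g0(1)])
    have "u \<otimes>\<^bsub>A\<^esub> g0 \<otimes>\<^bsub>A\<^esub> \<gamma> \<in> G" using mult_closed[OF ug] \<gamma> lattice_subset by blast
    then have "(u \<otimes>\<^bsub>A\<^esub> g0 \<otimes>\<^bsub>A\<^esub> \<gamma>) <#\<^bsub>A\<^esub> \<Gamma> \<in> W" using F(3) eq by blast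
    then have "(u \<otimes>\<^bsub>A\<^esub> g0) <#\<^bsub>A\<^esub> \<Gamma> \<in> W" by (simp only: lcoset_mult[OF ug \<gamma>])
    moreover have "u <#\<^bsub>A\<^esub> x = (u \<otimes>\<^bsub>A\<^esub> g0) <#\<^bsub>A\<^esub> \<Gamma>"
      unfolding g0(2)
      by (rule aut.lcos_m_assoc[OF subgroup.subset[OF lattice_subgroup] in_aut[OF uG] in_aut[OF g0(1)]])
    ultimately have "u <#\<^bsub>A\<^esub> x \<in> W" by (simp only:)
    moreover have "u <#\<^bsub>A\<^esub> x \<in> orbit ?H (\<lambda>g x. g <#\<^bsub>A\<^esub> x) x"
      unfolding orbit_def using u by auto
    ultimately show "\<exists>z. z \<in> orbit ?H (\<lambda>g x. g <#\<^bsub>A\<^esub> x) x \<and> z \<in> W" by blast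
  qed
  then show ?thesis
    unfolding minimal_action_def
    by (intro ballI equalityI closure_of_subset_topspace subsetI)
qed

end

theorem corollary1p2:
  fixes T :: "'v pair_pre_digraph" and V0 V1 :: "'v set" and d0 d1 :: nat
    and G \<Gamma> :: "('v \<Rightarrow> 'v) set" and \<xi> :: "(nat \<Rightarrow> 'v) set"
  assumes "biregular_tree T V0 V1 d0 d1" and "d0 \<ge> 3" and "d1 \<ge> 3"
    and "subgroup G (aut_group T V0 V1)"
    and "closedin (aut_topology T V0 V1) G"
    and "\<not> compactin (aut_topology T V0 V1) G"
    and "topologically_simple (subtopology (aut_topology T V0 V1) G)
          ((aut_group T V0 V1)\<lparr>carrier := G\<rparr>)"
    and "transitive_on_boundary T G"
    and "tits_independence T G"
    and "\<xi> \<in> tree_boundary T"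
    and "uniform_lattice (subtopology (aut_topology T V0 V1) G)
          ((aut_group T V0 V1)\<lparr>carrier := G\<rparr>) \<Gamma>"
  shows "minimal_action ((aut_group T V0 V1)\<lparr>carrier := horospherical_stabilizer T G \<xi>\<rparr>)
          (\<lambda>g x. g <#\<^bsub>aut_group T V0 V1\<^esub> x)
          (coset_space (subtopology (aut_topology T V0 V1) G)
            ((aut_group T V0 V1)\<lparr>carrier := G\<rparr>) \<Gamma>)"
proof -
  interpret biregular_tree T V0 V1 d0 d1 by fact
  interpret uniform_lattice_group T V0 V1 d0 d1 G \<Gamma>
    by (intro uniform_lattice_group.intro uniform_lattice_group_axioms.intro
        closed_tree_group.intro closed_tree_group_axioms.intro tree_group.intro
        tree_group_axioms.intro thick_tree.intro thick_tree_axioms.intro) fact+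
  show ?thesis by (rule minimal_horospherical_action) fact
qed

end
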